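(* Let $p$ be a prime, let $R$ be a perfect commutative, possibly non-unital, $\mathbb{F}_p$-algebra, and let $0\to I\to A\xrightarrow{\pi}R\to0$ be an exact sequence where $A$ is a commutative, possibly non-unital, ring without $p$-torsion equipped with a ring endomorphism $\phi$ which lifts the Frobenius endomorphism $x\mapsto x^p$ of $A/pA$ and such that $\phi$ is an isomorphism of $A$. Then the map $\alpha_n : A/I^n\to E_n(R)$ (for $n\ge1$) is an isomorphism with inverse $\phi^{1-n}\circ\mathrm{proj}_{n-1}\circ\mathcal{G}_{\mathrm{ref}}$, and we have $$E_n(\phi)\circ\alpha_n=\alpha_n\circ\phi .$$ The induced map $\hat\alpha : \varprojlim_n A/I^n\to E(R)$ is a topological isomorphism of topological rings.
   Context: All rings are commutative and possibly non-unital. Fix a prime $p$. For a ring $A$ and $N=\infty$ or $N=n\ge 1$, consider sequences in $A$ indexed by $0\le\nu<N$, with componentwise operations and the product topology ($A$ discrete). For $a\in A$ and $0\le\mu<N$ let $V^\mu\langle a\rangle$ be the sequence whose $\nu$-th component is $0$ for $\nu<\mu$ and $p^\mu a^{p^{\nu-\mu}}$ for $\nu\ge\mu$. Let $X(A)\subset A^{\mathbb{N}_0}$ (case $N=\infty$) and $X_n(A)\subset A^n$ (case $N=n$) be the closed additive subgroups generated by all $V^\mu\langle a\rangle$, $a\in A$; they are closed subrings, and for an ideal $I\subset A$ the corresponding groups $X(I)$, $X_n(I)$ (with $a\in I$) are closed ideals. For a ring $R$ and any presentation $0\to I\to A\xrightarrow{\pi}R\to0$ with $A$ without $p$-torsion,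 put $E(R)=X(A)/X(I)$ and $E_n(R)=X_n(A)/X_n(I)$ with quotient topologies; up to canonical isomorphism these topological rings do not depend on the presentation (the class of $V^\mu\langle a\rangle$ depends only on $\mu$ and $\pi(a)$, and these classes correspond to each other) and they are functorial in $R$ (isomorphic to the $p$-typical Witt vector rings $W(R)$, $W_n(R)$). On $A^{\mathbb{N}_0}$ let $V(a_0,a_1,\ldots)=p(0,a_0,a_1,\ldots)$; it induces $V$ on $E(R)$, and $V^nE(R)$ is the kernel of the projection $E(R)\to E_n(R)$. In the situation of the claim, the map $f : A\to A^{\mathbb{N}_0}$, $f(a)=(\phi^\nu(a))_{\nu\ge0}$ is a ring homomorphism with values in $X(A)$; $\alpha : A\to E(R)$ is $f$ followed by the quotient map $X(A)\to X(A)/X(I)=E(R)$. One has $\alpha(I^n)\subset V^nE(R)$, so $\alpha$ induces ring homomorphisms $\alpha_n : A/I^n\to E_n(R)$. The refined ghost map $\mathcal{G}_{\mathrm{ref}} : E_n(R)=X_n(A)/X_n(I)\to\prod_{\nu=0}^{n-1}A/I^{\nu+1}$ is the ring homomorphism induced by the inclusion $X_n(A)\subset A^n$; here one uses the inclusion $X_n(I)\subset\prod_{\nu=0}^{n-1}I^{\nu+1}$, which is based on $p\in I$ ($R$ being an $\mathbb{F}_p$-algebra). $\mathrm{proj}_{n-1}$ denotes the projection to the last factor $A/I^n$. The endomorphism $\phi$ of $A$ induces an automorphism of $A/I^n$, again denoted $\phi$; $E_n(\phi)$ is the map induced by functoriality from the Frobenius $\phi(r)=r^p$ of $R$. The rings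 $A/I^n$ are discrete and $\varprojlim_nA/I^n$ has the projective limit topology. An $\mathbb{F}_p$-algebra is perfect if its Frobenius endomorphism is an isomorphism.
   Formalization: For non-unital A the powers I^n are read with p counted as an element of I: I^{n+1} is generated by I^n·I and p·I^n (the usual power if A has a unit); with usual powers the claim fails, e.g. A = Q with zero product, I = A, R = 0, φ = id. *)

theory Defs
  imports
    "HOL-Analysis.Abstract_Topology"
    "HOL-Analysis.Function_Topology"
    "HOL-Library.Extended_Nat"
    "HOL-Library.Function_Algebras"
    "HOL-Library.Set_Algebras"
    "HOL-Computational_Algebra.Primes"
    "HOL-Computational_Algebra.Group_Closure"
begin

text \<open>
  Possibly non-unital commutative rings are types of class \<open>comm_ring\<close>, which has no unit element.
  Sequences are functions \<open>nat \<Rightarrow> 'a\<close> with the pointwise ring structure of \<open>Function_Algebras\<close>;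
  cosets are written \<open>a +o J\<close> and their sums \<open>C + D\<close>, as in \<open>Set_Algebras\<close>.
\<close>

section \<open>Non-unital rings\<close>

text \<open>The powers \<open>a ^ m\<close> of a non-unital ring exist for \<open>m \<ge> 1\<close> only; \<open>rpow a 0 = a\<close> is junk.\<close>

definition rpow :: "'a::semigroup_mult \<Rightarrow> nat \<Rightarrow> 'a" where
  "rpow a m = ((\<lambda>x. x * a) ^^ (m - 1)) a"

definition nsmul :: "nat \<Rightarrow> 'a::comm_monoid_add \<Rightarrow> 'a" where
  "nsmul m a = (\<Sum>_<m. a)"

definition rng_hom :: "('a::comm_ring \<Rightarrow> 'b::comm_ring) \<Rightarrow> bool" where
  "rng_hom h \<longleftrightarrow> (\<forall>x y. h (x + y) = h x + h y) \<and> (\<forall>x y. h (x * y) = h x * h y)"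

definition torsion_free :: "nat \<Rightarrow> 'a::comm_ring itself \<Rightarrow> bool" where
  "torsion_free p _ \<longleftrightarrow> (\<forall>a::'a. nsmul p a = 0 \<longrightarrow> a = 0)"

definition Fp_algebra :: "nat \<Rightarrow> 'r::comm_ring itself \<Rightarrow> bool" where
  "Fp_algebra p _ \<longleftrightarrow> (\<forall>r::'r. nsmul p r = 0)"

definition perfect :: "nat \<Rightarrow> 'r::comm_ring itself \<Rightarrow> bool" where
  "perfect p T \<longleftrightarrow> Fp_algebra p T \<and> bij (\<lambda>r::'r. rpow r p)"

definition lifts_Frobenius :: "nat \<Rightarrow> ('a::comm_ring \<Rightarrow> 'a) \<Rightarrow> bool" where
  "lifts_Frobenius p \<phi> \<longleftrightarrow> (\<forall>a. \<exists>b. \<phi> a - rpow a p = nsmul p b)"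

definition ker :: "('a::comm_ring \<Rightarrow> 'r::comm_ring) \<Rightarrow> 'a set" where
  "ker \<pi> = {a. \<pi> a = 0}"

text \<open>
  The power \<open>I\<^sup>n\<close> of an ideal \<open>I\<close> with \<open>p A \<subseteq> I\<close>, where \<open>p\<close> counts as an element of \<open>I\<close>: it is
  generated additively by the products of \<open>n\<close> factors, each of them an element of \<open>I\<close> or the
  multiplier \<open>p\<close>, not all of them \<open>p\<close>. If \<open>A\<close> has a unit, then \<open>p = p \<cdot> 1 \<in> I\<close> and this is the usual
  power \<open>plain_pow I n\<close>; in fact this holds whenever \<open>p I \<subseteq> I\<^sup>2\<close> (\<open>ideal_pow_eq_plain_pow\<close>).
  Without a unit, \<open>p I\<close> need not be contained in the usual \<open>I\<^sup>2\<close>, and for the usual powers neither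
  \<open>X\<^sub>n(I) \<subseteq> \<Prod>\<^sub>\<nu>\<^sub><\<^sub>n I\<^sup>\<nu>\<^sup>+\<^sup>1\<close> nor \<open>A/I\<^sup>n \<cong> E\<^sub>n(R)\<close> would hold: let \<open>A\<close> be the rational numbers
  with zero multiplication, \<open>I = A\<close>, \<open>R = 0\<close>, \<open>\<phi> = id\<close>; then \<open>E\<^sub>2(R) = 0\<close>, but the products of
  two elements of \<open>I\<close> vanish and \<open>p a \<noteq> 0\<close> for \<open>a \<noteq> 0\<close>. With \<open>p \<in> I\<close> read as
  above, \<open>I\<^sup>n\<close> is the intersection of \<open>A\<close> with the \<open>n\<close>-th power of the ideal \<open>\<int>p \<oplus> I\<close> of the
  unitalization \<open>\<int> \<oplus> A\<close>.
\<close>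

fun ideal_pow :: "nat \<Rightarrow> 'a::comm_ring set \<Rightarrow> nat \<Rightarrow> 'a set" where
  "ideal_pow p I 0 = UNIV"
| "ideal_pow p I (Suc 0) = I"
| "ideal_pow p I (Suc (Suc n)) =
     group_closure (ideal_pow p I (Suc n) * I \<union> nsmul p ` ideal_pow p I (Suc n))"

fun plain_pow :: "'a::comm_ring set \<Rightarrow> nat \<Rightarrow> 'a set" where
  "plain_pow I 0 = UNIV"
| "plain_pow I (Suc 0) = I"
| "plain_pow I (Suc (Suc n)) = group_closure (plain_pow I (Suc n) * I)"

lemma nsmul_0_right: "nsmul m 0 = 0"
  by (simp add: nsmul_def)

lemma nsmul_diff: "nsmul m (a - b) = nsmul m a - nsmul m (b :: 'a::comm_ring)"
  by (simp add: nsmul_def sum_subtractf)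

lemma nsmul_mult: "nsmul m (a * b) = nsmul m a * (b :: 'a::comm_ring)"
  by (simp add: nsmul_def sum_distrib_right)

lemma group_closure_mono: "S \<subseteq> T \<Longrightarrow> group_closure S \<subseteq> group_closure T"
proof
  fix x assume "x \<in> group_closure S" "S \<subseteq> T"
  then show "x \<in> group_closure T"
    by (induction rule: group_closure.induct) (auto intro: group_closure.intros)
qed

lemma group_closure_Un_absorb:
  assumes "T \<subseteq> group_closure S"
  shows "group_closure (S \<union> T) = group_closure S"
proof (intro equalityI subsetI)
  fix x assume "x \<in> group_closure (S \<union> T)"
  then show "x \<in> group_closure S"
    using assms by (induction rule: group_closure.induct) (auto intro: group_closure.intros)
next
  fix x assume "x \<in> group_closure S"
  then show "x \<in> group_closure (S \<union> T)" using group_closure_mono[of S "S \<union> T"] by auto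
qed

lemma nsmul_plain_pow:
  assumes "\<And>a. a \<in> I \<Longrightarrow> nsmul p a \<in> plain_pow I 2" and "x \<in> plain_pow I (Suc n)"
  shows "nsmul p x \<in> plain_pow I (Suc (Suc n))"
  using assms(2)
proof (induction n arbitrary: x)
  case 0
  then show ?case using assms(1) by (simp add: numeral_2_eq_2)
next
  case (Suc n)
  have *: "nsmul p s \<in> plain_pow I (Suc (Suc (Suc n)))" if s: "s \<in> plain_pow I (Suc n) * I" for s
  proof -
    from s obtain a b where ab: "s = a * b" "a \<in> plain_pow I (Suc n)" "b \<in> I"
      by (auto simp: set_times_def)
    then have "nsmul p a \<in> plain_pow I (Suc (Suc n))" using Suc.IH by blast
    then have "nsmul p a * b \<in> plain_pow I (Suc (Suc n)) * I"
      using ab by (auto simp: set_times_def)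
    then show ?thesis
      unfolding ab(1) nsmul_mult plain_pow.simps(3)[of I "Suc n"] by (auto intro: group_closure.base)
  qed
  from Suc.prems have "x \<in> group_closure (plain_pow I (Suc n) * I)" by simp
  then show ?case
  proof (induction rule: group_closure.induct)
    case (base s)
    then show ?case using * by (auto simp: nsmul_0_right)
  next
    case (diff s t)
    then show ?case by (auto simp: nsmul_diff intro: group_closure.diff)
  qed
qed

lemma ideal_pow_eq_plain_pow:
  assumes "\<And>a. a \<in> I \<Longrightarrow> nsmul p a \<in> plain_pow I 2"
  shows "ideal_pow p I n = plain_pow I n"
proof (induction n)
  case (Suc n)
  show ?case
  proof (cases n)
    case (Suc m)
    have "nsmul p ` plain_pow I (Suc m) \<subseteq> group_closure (plain_pow I (Suc m) * I)"
      using nsmul_plain_pow[OF assms] by auto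
    then show ?thesis using Suc.IH Suc by (simp add: group_closure_Un_absorb)
  qed simp
qed simp

lemma ideal_pow_unital:
  fixes I :: "'a::comm_ring set" and u :: 'a
  assumes "\<And>x. u * x = x" and "\<And>x. nsmul p x \<in> I"
  shows "ideal_pow p I n = plain_pow I n"
proof (rule ideal_pow_eq_plain_pow)
  fix a assume "a \<in> I"
  then have "nsmul p u * a \<in> I * I" using assms(2) by (auto simp: set_times_def)
  moreover have "nsmul p u * a = nsmul p a" by (simp add: nsmul_mult[symmetric] assms(1))
  ultimately show "nsmul p a \<in> plain_pow I 2"
    by (auto simp: numeral_2_eq_2 intro: group_closure.base)
qed

section \<open>Rings on a carrier set, quotients\<close>

record 'x rng =
  carr :: "'x set"
  radd :: "'x \<Rightarrow> 'x \<Rightarrow> 'x"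
  rmul :: "'x \<Rightarrow> 'x \<Rightarrow> 'x"

definition rng_homs :: "'x rng \<Rightarrow> 'y rng \<Rightarrow> ('x \<Rightarrow> 'y) set" where
  "rng_homs R S = {h. h \<in> carr R \<rightarrow> carr S \<and>
     (\<forall>x\<in>carr R. \<forall>y\<in>carr R. h (radd R x y) = radd S (h x) (h y) \<and>
                             h (rmul R x y) = rmul S (h x) (h y))}"

definition rng_isos :: "'x rng \<Rightarrow> 'y rng \<Rightarrow> ('x \<Rightarrow> 'y) set" where
  "rng_isos R S = {h \<in> rng_homs R S. bij_betw h (carr R) (carr S)}"

text \<open>
  The quotient of a subring \<open>S\<close> by an ideal \<open>J\<close> of \<open>S\<close>. The elementwise product of two cosets is in
  general smaller than a coset, hence the summand \<open>J\<close> in the multiplication.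
\<close>

definition quot :: "'a::comm_ring set \<Rightarrow> 'a set \<Rightarrow> 'a set rng" where
  "quot S J = \<lparr>carr = (\<lambda>s. s +o J) ` S, radd = (+), rmul = (\<lambda>C D. C * D + J)\<rparr>"

text \<open>The map on cosets induced by a map that is constant on cosets.\<close>

definition induced :: "('a \<Rightarrow> 'b) \<Rightarrow> 'a set \<Rightarrow> 'b" where
  "induced g C = the_elem (g ` C)"

definition quotient_top :: "'a topology \<Rightarrow> ('a \<Rightarrow> 'b) \<Rightarrow> 'b topology" where
  "quotient_top T q =
     topology (\<lambda>U. U \<subseteq> q ` topspace T \<and> openin T {x \<in> topspace T. q x \<in> U})"

lemma openin_quotient_top:
  "openin (quotient_top T q) U \<longleftrightarrow> U \<subseteq> q ` topspace T \<and> openin T {x \<in> topspace T. q x \<in> U}"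
proof -
  have "istopology (\<lambda>U. U \<subseteq> q ` topspace T \<and> openin T {x \<in> topspace T. q x \<in> U})"
    unfolding istopology_def
  proof (intro conjI allI impI)
    fix U V assume U: "U \<subseteq> q ` topspace T \<and> openin T {x \<in> topspace T. q x \<in> U}"
      and V: "V \<subseteq> q ` topspace T \<and> openin T {x \<in> topspace T. q x \<in> V}"
    have "{x \<in> topspace T. q x \<in> U \<inter> V} = {x \<in> topspace T. q x \<in> U} \<inter> {x \<in> topspace T. q x \<in> V}"
      by auto
    then show "openin T {x \<in> topspace T. q x \<in> U \<inter> V}" using U V by (simp add: openin_Int)
    show "U \<inter> V \<subseteq> q ` topspace T" using U by auto
  next
    fix K assume K: "\<forall>U\<in>K. U \<subseteq> q ` topspace T \<and> openin T {x \<in> topspace T. q x \<in> U}"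
    have "{x \<in> topspace T. q x \<in> \<Union> K} = (\<Union>U\<in>K. {x \<in> topspace T. q x \<in> U})"
      by auto
    then show "openin T {x \<in> topspace T. q x \<in> \<Union> K}" using K by auto
    show "\<Union> K \<subseteq> q ` topspace T" using K by auto
  qed
  then show ?thesis by (simp add: quotient_top_def)
qed

lemma quotient_map_quotient_top: "quotient_map T (quotient_top T q) q"
proof -
  have "openin (quotient_top T q) (q ` topspace T)"
  proof -
    have "{x \<in> topspace T. q x \<in> q ` topspace T} = topspace T" by auto
    then show ?thesis by (simp add: openin_quotient_top)
  qed
  then have "topspace (quotient_top T q) = q ` topspace T"
    by (metis openin_quotient_top openin_subset openin_topspace subset_antisym)
  then show ?thesis
    by (auto simp: quotient_map_def openin_quotient_top)
qed

section \<open>The rings \<open>X\<^sub>N(J)\<close> and \<open>E\<^sub>N(R)\<close>\<close>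

text \<open>
  The length \<open>N\<close> is an extended natural number. Sequences indexed by \<open>\<nu> < N\<close> are extended by zero.
\<close>

definition seqs :: "enat \<Rightarrow> (nat \<Rightarrow> 'a::comm_ring) set" where
  "seqs N = {s. \<forall>\<nu>. N \<le> enat \<nu> \<longrightarrow> s \<nu> = 0}"

definition seq_top :: "enat \<Rightarrow> (nat \<Rightarrow> 'a::comm_ring) topology" where
  "seq_top N = subtopology (product_topology (\<lambda>_. discrete_topology UNIV) UNIV) (seqs N)"

definition Vgen :: "nat \<Rightarrow> enat \<Rightarrow> nat \<Rightarrow> 'a::comm_ring \<Rightarrow> nat \<Rightarrow> 'a" where
  "Vgen p N \<mu> a =
     (\<lambda>\<nu>. if \<mu> \<le> \<nu> \<and> enat \<nu> < N then nsmul (p ^ \<mu>) (rpow a (p ^ (\<nu> - \<mu>))) else 0)"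

definition add_subgroup :: "'a::ab_group_add set \<Rightarrow> bool" where
  "add_subgroup H \<longleftrightarrow> 0 \<in> H \<and> (\<forall>x\<in>H. \<forall>y\<in>H. x - y \<in> H)"

definition X :: "nat \<Rightarrow> enat \<Rightarrow> 'a::comm_ring set \<Rightarrow> (nat \<Rightarrow> 'a) set" where
  "X p N J = (\<lambda>H. closedin (seq_top N) H \<and> add_subgroup H) hull
               {Vgen p N \<mu> a |\<mu> a. enat \<mu> < N \<and> a \<in> J}"

text \<open>
  \<open>E p N I\<close> is \<open>E\<^sub>N(A/I)\<close>, computed from the presentation \<open>A \<rightarrow> A/I\<close> where \<open>A\<close> is the whole type.
\<close>

definition E :: "nat \<Rightarrow> enat \<Rightarrow> 'a::comm_ring set \<Rightarrow> (nat \<Rightarrow> 'a) set rng" where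
  "E p N I = quot (X p N UNIV) (X p N I)"

definition E_top :: "nat \<Rightarrow> enat \<Rightarrow> 'a::comm_ring set \<Rightarrow> (nat \<Rightarrow> 'a) set topology" where
  "E_top p N I = quotient_top (subtopology (seq_top N) (X p N UNIV)) (\<lambda>s. s +o X p N I)"

definition trunc :: "nat \<Rightarrow> (nat \<Rightarrow> 'a::zero) \<Rightarrow> nat \<Rightarrow> 'a" where
  "trunc n s = (\<lambda>\<nu>. if \<nu> < n then s \<nu> else 0)"

definition E_proj :: "nat \<Rightarrow> 'a::comm_ring set \<Rightarrow> nat \<Rightarrow> (nat \<Rightarrow> 'a) set \<Rightarrow> (nat \<Rightarrow> 'a) set" where
  "E_proj p I n = induced (\<lambda>s. trunc n s +o X p (enat n) I)"

text \<open>
  Functoriality of \<open>E\<^sub>n\<close> in the ring: for \<open>h : R \<rightarrow> R'\<close> and presentations \<open>\<pi> : A \<rightarrow> R\<close>, \<open>\<pi>' : A' \<rightarrow> R'\<close>,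
  the ring homomorphism \<open>E\<^sub>n(h)\<close> sends the class of \<open>V\<^sup>\<mu>\<langle>a\<rangle>\<close> to that of \<open>V\<^sup>\<mu>\<langle>a'\<rangle>\<close> whenever
  \<open>\<pi>' a' = h (\<pi> a)\<close>. It is unique because these classes generate \<open>E\<^sub>n(R)\<close> as a group
  (\<open>A\<^sup>n\<close> is discrete for finite \<open>n\<close>).
\<close>

definition is_E_map ::
  "nat \<Rightarrow> nat \<Rightarrow> ('a::comm_ring \<Rightarrow> 'r::comm_ring) \<Rightarrow> ('b::comm_ring \<Rightarrow> 's::comm_ring) \<Rightarrow> ('r \<Rightarrow> 's)
    \<Rightarrow> ((nat \<Rightarrow> 'a) set \<Rightarrow> (nat \<Rightarrow> 'b) set) \<Rightarrow> bool" where
  "is_E_map p n \<pi> \<pi>' h F \<longleftrightarrow>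
     F \<in> rng_homs (E p (enat n) (ker \<pi>)) (E p (enat n) (ker \<pi>')) \<and>
     F \<in> extensional (carr (E p (enat n) (ker \<pi>))) \<and>
     (\<forall>\<mu><n. \<forall>a a'. \<pi>' a' = h (\<pi> a) \<longrightarrow>
        F (Vgen p (enat n) \<mu> a +o X p (enat n) (ker \<pi>)) =
          Vgen p (enat n) \<mu> a' +o X p (enat n) (ker \<pi>'))"

definition E_map ::
  "nat \<Rightarrow> nat \<Rightarrow> ('a::comm_ring \<Rightarrow> 'r::comm_ring) \<Rightarrow> ('b::comm_ring \<Rightarrow> 's::comm_ring) \<Rightarrow> ('r \<Rightarrow> 's)
    \<Rightarrow> (nat \<Rightarrow> 'a) set \<Rightarrow> (nat \<Rightarrow> 'b) set" where
  "E_map p n \<pi> \<pi>' h = (THE F. is_E_map p n \<pi> \<pi>' h F)"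

section \<open>The comparison maps\<close>

definition Quot_pow :: "nat \<Rightarrow> 'a::comm_ring set \<Rightarrow> nat \<Rightarrow> 'a set rng" where
  "Quot_pow p I n = quot UNIV (ideal_pow p I n)"

definition alpha :: "nat \<Rightarrow> ('a::comm_ring \<Rightarrow> 'a) \<Rightarrow> 'a set \<Rightarrow> 'a \<Rightarrow> (nat \<Rightarrow> 'a) set" where
  "alpha p \<phi> I a = (\<lambda>\<nu>. (\<phi> ^^ \<nu>) a) +o X p \<infinity> I"

definition alpha_n ::
  "nat \<Rightarrow> ('a::comm_ring \<Rightarrow> 'a) \<Rightarrow> 'a set \<Rightarrow> nat \<Rightarrow> 'a set \<Rightarrow> (nat \<Rightarrow> 'a) set" where
  "alpha_n p \<phi> I n = induced (\<lambda>a. E_proj p I n (alpha p \<phi> I a))"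

definition G_ref :: "nat \<Rightarrow> 'a::comm_ring set \<Rightarrow> nat \<Rightarrow> (nat \<Rightarrow> 'a) set \<Rightarrow> nat \<Rightarrow> 'a set" where
  "G_ref p I n = induced (\<lambda>s. \<lambda>\<nu>\<in>{..<n}. s \<nu> +o ideal_pow p I (\<nu> + 1))"

definition phi_quot :: "nat \<Rightarrow> ('a::comm_ring \<Rightarrow> 'a) \<Rightarrow> 'a set \<Rightarrow> nat \<Rightarrow> 'a set \<Rightarrow> 'a set" where
  "phi_quot p \<phi> I n = induced (\<lambda>a. \<phi> a +o ideal_pow p I n)"

definition phi_quot_inv :: "nat \<Rightarrow> ('a::comm_ring \<Rightarrow> 'a) \<Rightarrow> 'a set \<Rightarrow> nat \<Rightarrow> 'a set \<Rightarrow> 'a set" where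
  "phi_quot_inv p \<phi> I n = inv_into (carr (Quot_pow p I n)) (phi_quot p \<phi> I n)"

text \<open>The projective limit of the \<open>A/I\<^sup>n\<close> for \<open>n \<ge> 1\<close>, inside the product of these rings.\<close>

definition Proj_lim :: "nat \<Rightarrow> 'a::comm_ring set \<Rightarrow> (nat \<Rightarrow> 'a set) rng" where
  "Proj_lim p I =
     \<lparr>carr = {x \<in> \<Pi>\<^sub>E n\<in>{1..}. carr (Quot_pow p I n).
               \<forall>m n. 1 \<le> n \<and> n \<le> m \<longrightarrow> induced (\<lambda>a. a +o ideal_pow p I n) (x m) = x n},
      radd = (\<lambda>x y. \<lambda>n\<in>{1..}. radd (Quot_pow p I n) (x n) (y n)),
      rmul = (\<lambda>x y. \<lambda>n\<in>{1..}. rmul (Quot_pow p I n) (x n) (y n))\<rparr>"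

definition Proj_lim_top :: "nat \<Rightarrow> 'a::comm_ring set \<Rightarrow> (nat \<Rightarrow> 'a set) topology" where
  "Proj_lim_top p I = subtopology
     (product_topology (\<lambda>n. discrete_topology (carr (Quot_pow p I n))) {1..}) (carr (Proj_lim p I))"

text \<open>
  The map into \<open>E(R)\<close>, the projective limit of the \<open>E\<^sub>n(R)\<close>, whose components are the \<open>\<alpha>\<^sub>n\<close>.
\<close>

definition alpha_hat ::
  "nat \<Rightarrow> ('a::comm_ring \<Rightarrow> 'a) \<Rightarrow> 'a set \<Rightarrow> (nat \<Rightarrow> 'a set) \<Rightarrow> (nat \<Rightarrow> 'a) set" where
  "alpha_hat p \<phi> I x =
     (THE e. e \<in> carr (E p \<infinity> I) \<and> (\<forall>n\<ge>1. E_proj p I n e = alpha_n p \<phi> I n (x n)))"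

end

theory Submission
  imports Defs
begin

text \<open>
  Since \<open>A\<close> carries a Frobenius lift \<open>\<phi>\<close>, the closed group \<open>X(A)\<close> consists of all sequences
  \<open>s\<close> that satisfy Dwork's congruences \<open>s\<^sub>\<nu>\<^sub>+\<^sub>1 \<equiv> \<phi>(s\<^sub>\<nu>)\<close> modulo \<open>p\<^sup>\<nu>\<^sup>+\<^sup>1A\<close>. In the same way \<open>X(I)\<close> consists
  of those among them with \<open>s\<^sub>\<nu> \<in> I\<^sup>\<nu>\<^sup>+\<^sup>1\<close> for all \<open>\<nu>\<close> (\<open>X_eq_dwork\<close>). Both descriptions come from
  successive approximation: if the components of \<open>s\<close> before \<open>n\<close> vanish, then \<open>s\<^sub>n = p\<^sup>nb\<close>, and
  \<open>V\<^sup>n\<langle>b\<rangle>\<close> can be subtracted. For \<open>X(I)\<close> this requires that \<open>p\<^sup>nb \<in> I\<^sup>n\<^sup>+\<^sup>1\<close> implies \<open>b \<in> I\<close>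
  (\<open>nsmul_power_in_J_SucD\<close>). The proof of this fact is the heart of the matter. It uses the operator
  \<open>\<delta>(x) = (\<phi>(x) - x\<^sup>p) / p\<close>, which maps \<open>I\<^sup>n\<^sup>+\<^sup>1\<close> into \<open>I\<^sup>n\<close> (\<open>Frobenius_defect\<close>) and \<open>p\<^sup>nb\<close> to
  \<open>p\<^sup>n\<^sup>-\<^sup>1\<phi>(b)\<close> modulo \<open>p\<^sup>n\<close>; so the claim follows by induction on \<open>n\<close>, once one knows that
  \<open>\<phi>(b) \<in> I\<close> implies \<open>b \<in> I\<close>. The latter holds as the Frobenius of \<open>R\<close> is injective.

  With these descriptions the comparison becomes elementary. In a Dwork sequence of length \<open>n\<close> the
  last component determines the others up to \<open>X\<^sub>n(I)\<close>: if it lies in \<open>I\<^sup>n\<close>, then going backwards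
  along the congruences puts the component at \<open>\<nu>\<close> into \<open>I\<^sup>\<nu>\<^sup>+\<^sup>1\<close>, because \<open>\<phi>\<close> is bijective with
  \<open>\<phi>(I) = I\<close> (\<open>DI_if_last_component\<close>). Hence the class of \<open>s\<close> in \<open>E\<^sub>n(R)\<close> is the image of the
  element \<open>\<phi>\<^sup>1\<^sup>-\<^sup>n(s\<^sub>n\<^sub>-\<^sub>1)\<close>, which is well defined modulo \<open>I\<^sup>n\<close>, and this is the asserted inverse of
  \<open>\<alpha>\<^sub>n\<close>. On representatives \<open>E\<^sub>n(\<phi>)\<close> is the componentwise application of \<open>\<phi>\<close>, and this commutes
  with \<open>a \<mapsto> (\<phi>\<^sup>\<nu>(a))\<^sub>\<nu>\<close>.

  In the limit, membership in \<open>X(I)\<close> is a condition on the single components, which makes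
  \<open>E(R) \<rightarrow> lim E\<^sub>n(R)\<close> injective. It is onto because every element of \<open>X\<^sub>n(I)\<close> extends to an
  element of \<open>X(I)\<close> (\<open>trunc_surj_DI\<close>), so that representatives at the finite levels can be
  corrected to a convergent sequence (\<open>lifts_exists\<close>). The same extension property shows that
  \<open>alpha_hat\<close> is continuous; its inverse is continuous since its \<open>n\<close>-th component depends on
  \<open>s\<^sub>n\<^sub>-\<^sub>1\<close> only.
\<close>

section \<open>Multiples and powers in a non-unital ring\<close>

lemma nsmul_0_left [simp]: "nsmul 0 a = 0"
  by (simp add: nsmul_def)

lemma nsmul_Suc: "nsmul (Suc m) a = a + nsmul m a"
  by (simp add: nsmul_def add.commute)

lemma nsmul_1 [simp]: "nsmul (Suc 0) a = a"
  by (simp add: nsmul_def)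

declare nsmul_0_right [simp]

lemma nsmul_add: "nsmul m (a + b) = nsmul m a + nsmul m b"
  by (simp add: nsmul_def sum.distrib)

lemma nsmul_add_left: "nsmul (m + k) a = nsmul m a + nsmul k a"
  by (induction m) (simp_all add: nsmul_Suc add.assoc)

lemma nsmul_nsmul: "nsmul m (nsmul k a) = nsmul (m * k) a"
  by (induction m) (simp_all add: nsmul_Suc nsmul_add_left)

lemma nsmul_mult_left: "a * nsmul m b = nsmul m (a * b)" for a :: "'a::comm_ring"
  by (simp add: nsmul_def sum_distrib_left)

lemma nsmul_mult_right: "nsmul m a * b = nsmul m (a * b)" for a :: "'a::comm_ring"
  by (simp add: nsmul_mult)

lemma nsmul_sum: "nsmul m (\<Sum>i\<in>K. f i) = (\<Sum>i\<in>K. nsmul m (f i))"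
  unfolding nsmul_def by (rule sum.swap)

lemma nsmul_power_Suc: "nsmul (p ^ Suc k) a = nsmul p (nsmul (p ^ k) a)"
  by (simp add: nsmul_nsmul)

lemma rpow_1 [simp]: "rpow a (Suc 0) = a"
  by (simp add: rpow_def)

lemma rpow_Suc: "m \<ge> 1 \<Longrightarrow> rpow a (Suc m) = rpow a m * a"
  by (cases m) (auto simp: rpow_def)

lemma rpow_add:
  assumes "k \<ge> 1" "m \<ge> 1"
  shows "rpow a (k + m) = rpow a k * rpow a m"
  using assms(2)
proof (induction m rule: dec_induct)
  case base
  then show ?case using assms(1) by (simp add: rpow_Suc)
next
  case (step m)
  then show ?case using assms(1) by (simp add: rpow_Suc mult.assoc)
qed

lemma rpow_rpow:
  assumes "k \<ge> 1" "m \<ge> 1"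
  shows "rpow (rpow a k) m = rpow a (k * m)"
  using assms(2)
proof (induction m rule: dec_induct)
  case base
  then show ?case by simp
next
  case (step m)
  then have "rpow (rpow a k) (Suc m) = rpow a (k * m) * rpow a k" by (simp add: rpow_Suc)
  also have "\<dots> = rpow a (k * m + k)" using assms(1) step(1) by (subst rpow_add) auto
  finally show ?case by (simp add: algebra_simps)
qed

lemma rpow_nsmul:
  fixes a :: "'a::comm_ring"
  assumes "m \<ge> 1"
  shows "rpow (nsmul k a) m = nsmul (k ^ m) (rpow a m)"
  using assms
  by (induction m rule: dec_induct)
     (simp_all add: rpow_Suc nsmul_mult_left nsmul_mult_right nsmul_nsmul mult.commute)

lemma rpow_zero: "m \<ge> 1 \<Longrightarrow> rpow (0::'a::comm_ring) m = 0"
  by (induction m rule: dec_induct) (simp_all add: rpow_Suc)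

lemma rng_homD:
  assumes "rng_hom h"
  shows "h (x + y) = h x + h y" "h (x * y) = h x * h y"
  using assms by (auto simp: rng_hom_def)

lemma rng_hom_zero: "rng_hom h \<Longrightarrow> h 0 = 0"
  using rng_homD(1)[of h 0 0] by simp

lemma rng_hom_diff: "rng_hom h \<Longrightarrow> h (x - y) = h x - h y"
  using rng_homD(1)[of h "x - y" y] by simp

lemma rng_hom_nsmul: "rng_hom h \<Longrightarrow> h (nsmul m x) = nsmul m (h x)"
  by (induction m) (simp_all add: nsmul_Suc rng_homD rng_hom_zero)

lemma rng_hom_rpow: "rng_hom h \<Longrightarrow> m \<ge> 1 \<Longrightarrow> h (rpow x m) = rpow (h x) m"
  by (rotate_tac, induction m rule: dec_induct) (simp_all add: rpow_Suc rng_homD)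

lemma add_subgroupD:
  assumes "add_subgroup H"
  shows "0 \<in> H" "x \<in> H \<Longrightarrow> y \<in> H \<Longrightarrow> x - y \<in> H" "x \<in> H \<Longrightarrow> - x \<in> H"
    "x \<in> H \<Longrightarrow> y \<in> H \<Longrightarrow> x + y \<in> H"
proof -
  show *: "0 \<in> H" "\<And>x y. x \<in> H \<Longrightarrow> y \<in> H \<Longrightarrow> x - y \<in> H"
    using assms by (auto simp: add_subgroup_def)
  show m: "- x \<in> H" if "x \<in> H" for x using *(2)[OF *(1) that] by simp
  show "x + y \<in> H" if "x \<in> H" "y \<in> H" using *(2)[OF that(1) m[OF that(2)]] by simp
qed

lemma add_subgroup_sum:
  "add_subgroup H \<Longrightarrow> (\<And>i. i \<in> K \<Longrightarrow> f i \<in> H) \<Longrightarrow> (\<Sum>i\<in>K. f i) \<in> H"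
  by (induction K rule: infinite_finite_induct) (auto intro: add_subgroupD)

lemma add_subgroup_nsmul: "add_subgroup H \<Longrightarrow> x \<in> H \<Longrightarrow> nsmul m x \<in> H"
  unfolding nsmul_def by (rule add_subgroup_sum)

lemma add_subgroup_group_closure: "add_subgroup (group_closure S)"
  by (auto simp: add_subgroup_def intro: group_closure.intros)

text \<open>
  \<open>mixed y z m k\<close> is \<open>y\<^sup>k z\<^sup>m\<^sup>-\<^sup>k\<close>. Without a unit the two boundary terms are not products, and naming
  the whole family makes the binomial formula and its induction uniform in \<open>k\<close>.
\<close>

definition mixed :: "'a::comm_ring \<Rightarrow> 'a \<Rightarrow> nat \<Rightarrow> nat \<Rightarrow> 'a" where
  "mixed y z m k = (if k = 0 then rpow z m else if k = m then rpow y m else rpow y k * rpow z (m - k))"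

lemma mixed_mult_left:
  assumes "m \<ge> 1" "k \<le> m"
  shows "mixed y z m k * y = mixed y z (Suc m) (Suc k)"
proof -
  have "k = 0 \<or> k = m \<or> (1 \<le> k \<and> k < m)" using assms by auto
  then show ?thesis
    using assms by (elim disjE) (auto simp: mixed_def rpow_Suc ac_simps)
qed

lemma mixed_mult_right:
  assumes "m \<ge> 1" "k \<le> m"
  shows "mixed y z m k * z = mixed y z (Suc m) k"
proof -
  have "k = 0 \<or> k = m \<or> (1 \<le> k \<and> k < m)" using assms by auto
  then show ?thesis
    using assms by (elim disjE) (auto simp: mixed_def rpow_Suc ac_simps Suc_diff_le)
qed

lemma rpow_binomial:
  assumes "m \<ge> 1"
  shows "rpow (y + z) m = (\<Sum>k\<le>m. nsmul (m choose k) (mixed y z m k))"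
  using assms
proof (induction m rule: dec_induct)
  case base
  show ?case by (simp add: mixed_def add.commute)
next
  case (step m)
  let ?f = "\<lambda>k. mixed y z (Suc m) k"
  have y: "rpow (y + z) m * y = (\<Sum>k\<le>m. nsmul (m choose k) (?f (Suc k)))"
    unfolding step.IH sum_distrib_right
    by (rule sum.cong) (use step.hyps in \<open>auto simp: nsmul_mult_right mixed_mult_left\<close>)
  have "rpow (y + z) m * z = (\<Sum>k\<le>m. nsmul (m choose k) (?f k))"
    unfolding step.IH sum_distrib_right
    by (rule sum.cong) (use step.hyps in \<open>auto simp: nsmul_mult_right mixed_mult_right\<close>)
  also have "\<dots> = (\<Sum>k\<le>Suc m. nsmul (m choose k) (?f k))"
    by (simp add: binomial_eq_0)
  also have "\<dots> = ?f 0 + (\<Sum>k\<le>m. nsmul (m choose Suc k) (?f (Suc k)))"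
    by (subst sum.atMost_Suc_shift) simp
  finally have z: "rpow (y + z) m * z = ?f 0 + (\<Sum>k\<le>m. nsmul (m choose Suc k) (?f (Suc k)))" .
  have "(\<Sum>k\<le>Suc m. nsmul (Suc m choose k) (?f k))
      = ?f 0 + (\<Sum>k\<le>m. nsmul (m choose k) (?f (Suc k)) + nsmul (m choose Suc k) (?f (Suc k)))"
    by (subst sum.atMost_Suc_shift) (simp add: nsmul_add_left)
  also have "\<dots> = rpow (y + z) m * (y + z)"
    unfolding distrib_left y z by (simp add: sum.distrib algebra_simps)
  finally show ?case using step.hyps by (simp add: rpow_Suc)
qed

definition rng_ideal :: "'a::comm_ring set \<Rightarrow> bool" where
  "rng_ideal S \<longleftrightarrow> add_subgroup S \<and> (\<forall>x\<in>S. \<forall>a. x * a \<in> S)"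

lemma rng_idealD:
  assumes "rng_ideal S"
  shows "add_subgroup S" "x \<in> S \<Longrightarrow> x * a \<in> S" "x \<in> S \<Longrightarrow> a * x \<in> S"
proof -
  show "add_subgroup S" and *: "x \<in> S \<Longrightarrow> x * a \<in> S"
    using assms by (auto simp: rng_ideal_def)
  show "x \<in> S \<Longrightarrow> a * x \<in> S" using * by (simp add: mult.commute)
qed

lemma rng_ideal_rpow:
  assumes "rng_ideal S" "z \<in> S" "m \<ge> 1"
  shows "rpow z m \<in> S"
  using assms(3,2) by (induction m rule: dec_induct) (simp_all add: rpow_Suc rng_idealD[OF assms(1)])

lemma rng_ideal_multiples: "rng_ideal (range (nsmul m) :: 'a::comm_ring set)"
  unfolding rng_ideal_def add_subgroup_def
  by (auto simp: nsmul_mult_right simp flip: nsmul_diff intro: range_eqI[of _ _ 0])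

text \<open>
  The mixed terms of the \<open>p\<close>-th power of a sum have coefficients divisible by \<open>p\<close>; the remaining
  factor lies in every ideal that contains one of the two summands.
\<close>

lemma prime_rpow_add:
  fixes y z :: "'a::comm_ring"
  assumes "prime p" "rng_ideal S" "z \<in> S"
  shows "\<exists>c\<in>S. rpow (y + z) p = rpow y p + rpow z p + nsmul p c"
proof
  let ?c = "\<Sum>k\<in>{1..<p}. nsmul ((p choose k) div p) (mixed y z p k)"
  have p: "p > 1" using assms(1) by (rule prime_gt_1_nat)
  have "mixed y z p k \<in> S" if "k \<in> {1..<p}" for k
    using that assms(2,3) by (auto simp: mixed_def intro!: rng_idealD(3) rng_ideal_rpow)
  then show "?c \<in> S"
    using rng_idealD(1)[OF assms(2)] by (intro add_subgroup_sum add_subgroup_nsmul)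
  have "{..p} = insert 0 (insert p {1..<p})" using p by auto
  then have "rpow (y + z) p
      = rpow y p + rpow z p + (\<Sum>k\<in>{1..<p}. nsmul (p choose k) (mixed y z p k))"
    using p by (simp add: rpow_binomial mixed_def[of y z p 0] mixed_def[of y z p p] algebra_simps)
  also have "(\<Sum>k\<in>{1..<p}. nsmul (p choose k) (mixed y z p k)) = nsmul p ?c"
    unfolding nsmul_sum
  proof (rule sum.cong[OF refl])
    fix k assume k: "k \<in> {1..<p}"
    have "p dvd (p choose k)" by (rule dvd_choose_prime) (use assms(1) k in auto)
    then show "nsmul (p choose k) (mixed y z p k) = nsmul p (nsmul ((p choose k) div p) (mixed y z p k))"
      by (simp add: nsmul_nsmul)
  qed
  finally show "rpow (y + z) p = rpow y p + rpow z p + nsmul p ?c" .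
qed


text \<open>
  Raising to the \<open>p\<close>-th power improves a congruence by one step along any filtration by ideals in
  which multiplication by \<open>p\<close> and \<open>p\<close>-th powers do so. The proof uses this for the powers of an
  ideal and for the multiples of the powers of \<open>p\<close>.
\<close>

lemma rpow_prime_power_cong:
  fixes S :: "nat \<Rightarrow> 'a::comm_ring set"
  assumes p: "prime p"
    and S: "\<And>m. rng_ideal (S m)"
    and mult: "\<And>m z. z \<in> S m \<Longrightarrow> nsmul p z \<in> S (Suc m)"
    and power: "\<And>m z. m \<ge> 1 \<Longrightarrow> z \<in> S m \<Longrightarrow> rpow z p \<in> S (Suc m)"
    and xy: "x - y \<in> S 1"
  shows "rpow x (p ^ k) - rpow y (p ^ k) \<in> S (Suc k)"
proof (induction k)
  case 0
  then show ?case using xy by simp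
next
  case (Suc k)
  let ?x = "rpow x (p ^ k)" and ?y = "rpow y (p ^ k)"
  have p1: "p \<ge> 1" using prime_gt_0_nat[OF p] by simp
  have pow: "rpow a (p ^ Suc k) = rpow (rpow a (p ^ k)) p" for a :: 'a
    using p1 by (simp add: rpow_rpow mult.commute)
  obtain c where c: "c \<in> S (Suc k)" "rpow (?y + (?x - ?y)) p = rpow ?y p + rpow (?x - ?y) p + nsmul p c"
    using prime_rpow_add[OF p S Suc.IH] by blast
  then have "rpow ?x p - rpow ?y p = rpow (?x - ?y) p + nsmul p c"
    by (simp add: algebra_simps)
  also have "\<dots> \<in> S (Suc (Suc k))"
    using c(1) Suc.IH by (intro add_subgroupD(4)[OF rng_idealD(1)[OF S]] mult power) auto
  finally show ?case by (simp only: pow)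
qed

section \<open>Topology of sequence spaces\<close>

lemma openin_discrete_sequences:
  fixes S U :: "(nat \<Rightarrow> 'a) set"
  shows "openin (subtopology (product_topology (\<lambda>_. discrete_topology UNIV) UNIV) S) U \<longleftrightarrow>
     U \<subseteq> S \<and> (\<forall>s\<in>U. \<exists>n. \<forall>t\<in>S. (\<forall>\<nu><n. t \<nu> = s \<nu>) \<longrightarrow> t \<in> U)"
    (is "openin (subtopology ?T S) U \<longleftrightarrow> ?R")
proof
  assume "openin (subtopology ?T S) U"
  then obtain W where W: "openin ?T W" "U = W \<inter> S" by (auto simp: openin_subtopology)
  show ?R
  proof (intro conjI ballI)
    fix s assume "s \<in> U"
    then have "s \<in> W" using W by simp
    then obtain C where C: "finite {i. C i \<noteq> UNIV}" "s \<in> Pi\<^sub>E UNIV C" "Pi\<^sub>E UNIV C \<subseteq> W"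
      using W(1) by (auto simp: openin_product_topology_alt)
    obtain n where n: "\<And>i. C i \<noteq> UNIV \<Longrightarrow> i < n"
      using C(1) finite_nat_set_iff_bounded by auto
    have "t \<in> U" if "t \<in> S" "\<forall>\<nu><n. t \<nu> = s \<nu>" for t
    proof -
      have "t i \<in> C i" for i
        using n[of i] that(2) C(2) by (cases "C i = UNIV") (auto simp: PiE_iff)
      then show ?thesis using C(3) W(2) that(1) by auto
    qed
    then show "\<exists>n. \<forall>t\<in>S. (\<forall>\<nu><n. t \<nu> = s \<nu>) \<longrightarrow> t \<in> U" by blast
  qed (use W in auto)
next
  assume R: ?R
  then obtain m where m: "\<And>s t. s \<in> U \<Longrightarrow> t \<in> S \<Longrightarrow> \<forall>\<nu><m s. t \<nu> = s \<nu> \<Longrightarrow> t \<in> U" by metis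
  let ?C = "\<lambda>s. Pi\<^sub>E UNIV (\<lambda>\<nu>. if \<nu> < m s then {s \<nu>} else UNIV)"
  have "openin ?T (?C s)" for s
  proof (rule product_topology_basis)
    have "{i. (if i < m s then {s i} else UNIV) \<noteq> topspace (discrete_topology UNIV)} \<subseteq> {..<m s}"
      by auto
    then show "finite {i. (if i < m s then {s i} else UNIV) \<noteq> topspace (discrete_topology UNIV)}"
      by (rule finite_subset) simp
  qed simp
  then have "openin ?T (\<Union>s\<in>U. ?C s)" by blast
  moreover have "U = (\<Union>s\<in>U. ?C s) \<inter> S"
  proof (intro equalityI subsetI)
    fix t assume "t \<in> (\<Union>s\<in>U. ?C s) \<inter> S"
    then obtain s where s: "s \<in> U" "t \<in> ?C s" "t \<in> S" by blast
    have "t \<nu> = s \<nu>" if "\<nu> < m s" for \<nu>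
      using PiE_mem[OF s(2), of \<nu>] that by simp
    then show "t \<in> U" using m s by blast
  qed (use R in \<open>auto simp: PiE_iff\<close>)
  ultimately show "openin (subtopology ?T S) U" by (auto simp: openin_subtopology)
qed

lemma topspace_seq_top: "topspace (seq_top N) = seqs N"
  by (simp add: seq_top_def)

lemma openin_subtopology_seq_top:
  assumes "S \<subseteq> seqs N"
  shows "openin (subtopology (seq_top N) S) U \<longleftrightarrow>
     U \<subseteq> S \<and> (\<forall>s\<in>U. \<exists>n. \<forall>t\<in>S. (\<forall>\<nu><n. t \<nu> = s \<nu>) \<longrightarrow> t \<in> U)"
proof -
  have "seqs N \<inter> S = S" using assms by auto
  then show ?thesis
    by (simp add: seq_top_def subtopology_subtopology openin_discrete_sequences)
qed

lemma closedin_seq_top: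
  "closedin (seq_top N) H \<longleftrightarrow>
     H \<subseteq> seqs N \<and> (\<forall>s\<in>seqs N. (\<forall>n. \<exists>h\<in>H. \<forall>\<nu><n. h \<nu> = s \<nu>) \<longrightarrow> s \<in> H)"
proof -
  have "openin (seq_top N) (seqs N - H) \<longleftrightarrow>
      (\<forall>s\<in>seqs N - H. \<exists>n. \<forall>t\<in>seqs N. (\<forall>\<nu><n. t \<nu> = s \<nu>) \<longrightarrow> t \<in> seqs N - H)"
    by (simp add: seq_top_def openin_discrete_sequences)
  moreover have "(\<forall>t\<in>seqs N. (\<forall>\<nu><n. t \<nu> = s \<nu>) \<longrightarrow> t \<in> seqs N - H) \<longleftrightarrow> \<not> (\<exists>h\<in>H. \<forall>\<nu><n. h \<nu> = s \<nu>)"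
    if "H \<subseteq> seqs N" for n s
    using that by blast
  ultimately have "H \<subseteq> seqs N \<Longrightarrow>
      openin (seq_top N) (seqs N - H) \<longleftrightarrow> (\<forall>s\<in>seqs N - H. \<exists>n. \<not> (\<exists>h\<in>H. \<forall>\<nu><n. h \<nu> = s \<nu>))"
    by simp
  then show ?thesis
    unfolding closedin_def topspace_seq_top by blast
qed

section \<open>Cosets\<close>

lemma coset_eq_iff: "add_subgroup J \<Longrightarrow> a +o J = b +o J \<longleftrightarrow> a - b \<in> J"
proof
  assume J: "add_subgroup J"
  show "a - b \<in> J" if "a +o J = b +o J"
  proof -
    have "a + 0 \<in> a +o J" using add_subgroupD(1)[OF J] by (rule set_plus_intro2)
    then show ?thesis using that set_plus_imp_minus[of a b J] by simp
  qed
  show "a +o J = b +o J" if ab: "a - b \<in> J"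
  proof -
    have "x - a \<in> J \<longleftrightarrow> x - b \<in> J" for x
      using add_subgroupD(4)[OF J, of "x - a" "a - b"] add_subgroupD(2)[OF J, of "x - b" "a - b"] ab
      by auto
    then show ?thesis by (auto simp flip: set_minus_plus)
  qed
qed

lemma coset_plus: "add_subgroup J \<Longrightarrow> (a +o J) + (b +o J) = (a + b) +o J"
proof -
  assume J: "add_subgroup J"
  have "J + J = J"
    using add_subgroupD(1,4)[OF J] by (auto elim!: set_plus_elim intro: set_zero_plus2[THEN subsetD])
  then show ?thesis by (simp add: set_plus_rearrange)
qed

definition ideal_in :: "'a::comm_ring set \<Rightarrow> 'a set \<Rightarrow> bool" where
  "ideal_in S J \<longleftrightarrow> add_subgroup J \<and> J \<subseteq> S \<and> (\<forall>x\<in>J. \<forall>y\<in>S. x * y \<in> J)"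

lemma ideal_inD:
  assumes "ideal_in S J"
  shows "add_subgroup J" "J \<subseteq> S" "x \<in> J \<Longrightarrow> y \<in> S \<Longrightarrow> x * y \<in> J" "x \<in> J \<Longrightarrow> y \<in> S \<Longrightarrow> y * x \<in> J"
proof -
  show "add_subgroup J" "J \<subseteq> S" and *: "x \<in> J \<Longrightarrow> y \<in> S \<Longrightarrow> x * y \<in> J"
    using assms by (simp_all add: ideal_in_def)
  then show "x \<in> J \<Longrightarrow> y \<in> S \<Longrightarrow> y * x \<in> J" by (simp add: mult.commute)
qed

lemma coset_times:
  assumes J: "ideal_in S J" and "a \<in> S" "b \<in> S"
  shows "(a +o J) * (b +o J) + J = (a * b) +o J"
proof (intro equalityI subsetI)
  fix x assume "x \<in> (a +o J) * (b +o J) + J"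
  then obtain i j k where ijk: "i \<in> J" "j \<in> J" "k \<in> J" "x = (a + i) * (b + j) + k"
    by (auto elim!: set_plus_elim set_times_elim simp: elt_set_plus_def)
  have "x - a * b = a * j + i * b + i * j + k" by (simp add: ijk(4) algebra_simps)
  also have "\<dots> \<in> J"
    using ijk assms(2,3) ideal_inD(2)[OF J]
    by (intro add_subgroupD(4)[OF ideal_inD(1)[OF J]]) (auto intro: ideal_inD(3,4)[OF J])
  finally show "x \<in> (a * b) +o J" by (rule set_minus_imp_plus)
next
  fix x assume "x \<in> (a * b) +o J"
  then obtain j where j: "j \<in> J" "x = a * b + j" by (auto simp: elt_set_plus_def)
  have "c \<in> c +o J" for c
    using set_plus_intro2[OF add_subgroupD(1)[OF ideal_inD(1)[OF J]], of c] by simp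
  then show "x \<in> (a +o J) * (b +o J) + J"
    unfolding j(2) using j(1) by (intro set_plus_intro set_times_intro)
qed

lemma induced_coset:
  assumes "add_subgroup J" "\<And>j. j \<in> J \<Longrightarrow> g (a + j) = g a"
  shows "induced g (a +o J) = g a"
proof -
  have "g ` (a +o J) = {g a}"
    using assms(2) add_subgroupD(1)[OF assms(1)] by (auto simp: elt_set_plus_def image_iff)
  then show ?thesis by (simp add: induced_def)
qed

lemma carr_quot: "carr (quot S J) = (\<lambda>s. s +o J) ` S"
  and radd_quot: "radd (quot S J) = (+)"
  and rmul_quot: "rmul (quot S J) = (\<lambda>C D. C * D + J)"
  by (simp_all add: quot_def)

lemma quot_rng_homsI:
  assumes J: "ideal_in S J" and J': "ideal_in S' J'"
    and S: "\<And>a b. a \<in> S \<Longrightarrow> b \<in> S \<Longrightarrow> a + b \<in> S" "\<And>a b. a \<in> S \<Longrightarrow> b \<in> S \<Longrightarrow> a * b \<in> S"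
    and g: "\<And>a. a \<in> S \<Longrightarrow> g a \<in> S'" "\<And>a. a \<in> S \<Longrightarrow> h (a +o J) = g a +o J'"
    and hom: "\<And>a b. g (a + b) = g a + g b" "\<And>a b. g (a * b) = g a * g b"
  shows "h \<in> rng_homs (quot S J) (quot S' J')"
  unfolding rng_homs_def
proof (intro CollectI conjI ballI funcsetI, goal_cases)
  case (1 x)
  then show ?case using g by (auto simp: carr_quot)
next
  case (2 x y)
  then obtain a b where ab: "a \<in> S" "b \<in> S" "x = a +o J" "y = b +o J" by (auto simp: carr_quot)
  then have "x + y = (a + b) +o J" using coset_plus[OF ideal_inD(1)[OF J]] by simp
  then show ?case
    using ab g S hom coset_plus[OF ideal_inD(1)[OF J']] by (simp add: radd_quot)
next
  case (3 x y)
  then obtain a b where ab: "a \<in> S" "b \<in> S" "x = a +o J" "y = b +o J" by (auto simp: carr_quot)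
  then have "x * y + J = (a * b) +o J" using coset_times[OF J] by simp
  then show ?case
    using ab g S hom coset_times[OF J'] by (simp add: rmul_quot)
qed

section \<open>The filtration by powers of an ideal under a Frobenius lift\<close>

text \<open>
  \<open>I\<close> plays the role of the kernel of a presentation of an \<open>\<F>\<^sub>p\<close>-algebra \<open>R = A/I\<close>. That the Frobenius
  of \<open>R\<close> is injective is expressed in terms of \<open>I\<close> by the last assumption.
\<close>

locale frobenius_ideal =
  fixes p :: nat
    and \<phi> :: "'a::comm_ring \<Rightarrow> 'a"
    and I :: "'a set"
  assumes p: "prime p"
    and torsion: "torsion_free p TYPE('a)"
    and hom: "rng_hom \<phi>"
    and lift: "lifts_Frobenius p \<phi>"
    and bij: "bij \<phi>"
    and ideal: "rng_ideal I"
    and p_mem: "nsmul p a \<in> I"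
    and phi_mem_iff: "\<phi> a \<in> I \<longleftrightarrow> a \<in> I"
begin

abbreviation J :: "nat \<Rightarrow> 'a set" where
  "J \<equiv> ideal_pow p I"

abbreviation P :: "nat \<Rightarrow> 'a set" where
  "P k \<equiv> range (nsmul (p ^ k))"

lemma p_ge_1: "p \<ge> 1"
  using prime_gt_0_nat[OF p] by simp

lemma p_power_ge_1: "p ^ k \<ge> 1"
  using p_ge_1 by simp

lemma Suc_le_p_power: "Suc k \<le> p ^ k"
  using power_gt_expt[of p k] prime_gt_1_nat[OF p] by simp

lemma torsion_cancel: "nsmul p a = nsmul p b \<Longrightarrow> a = (b::'a)"
  using torsion nsmul_diff[of p a b] by (auto simp: torsion_free_def)

lemma J_Suc: "n \<ge> 1 \<Longrightarrow> J (Suc n) = group_closure (J n * I \<union> nsmul p ` J n)"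
  by (cases n) auto

lemma add_subgroup_J: "add_subgroup (J n)"
proof (cases n)
  case 0
  then show ?thesis by (simp add: add_subgroup_def)
next
  case (Suc m)
  then show ?thesis using rng_idealD(1)[OF ideal]
    by (cases m) (simp_all add: add_subgroup_group_closure)
qed

lemma J_mult_I: "a \<in> J n \<Longrightarrow> b \<in> I \<Longrightarrow> a * b \<in> J (Suc n)"
  by (cases "n = 0") (auto simp: J_Suc rng_idealD(3)[OF ideal] intro!: group_closure.base)

lemma J_nsmul: "a \<in> J n \<Longrightarrow> nsmul p a \<in> J (Suc n)"
  by (cases "n = 0") (auto simp: J_Suc p_mem intro!: group_closure.base)

lemma J_Suc_induct [consumes 2, case_names mult nsmul diff]:
  assumes "n \<ge> 1" "x \<in> J (Suc n)"
    and "\<And>a b. a \<in> J n \<Longrightarrow> b \<in> I \<Longrightarrow> Q (a * b)"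
    and "\<And>a. a \<in> J n \<Longrightarrow> Q (nsmul p a)"
    and "\<And>x y. x \<in> J (Suc n) \<Longrightarrow> y \<in> J (Suc n) \<Longrightarrow> Q x \<Longrightarrow> Q y \<Longrightarrow> Q (x - y)"
  shows "Q x"
proof -
  have zero: "Q 0" using assms(4)[of 0] add_subgroupD(1)[OF add_subgroup_J] by simp
  from assms(2) have "x \<in> group_closure (J n * I \<union> nsmul p ` J n)"
    using J_Suc[OF assms(1)] by simp
  then show ?thesis
  proof (induction rule: group_closure.induct)
    case (base s)
    then show ?case using zero assms(3,4) by (auto elim!: set_times_elim)
  next
    case (diff s t)
    then show ?case using assms(5) J_Suc[OF assms(1)] by simp
  qed
qed

lemma J_mult_right: "x \<in> J n \<Longrightarrow> x * a \<in> J n"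
proof (induction n arbitrary: x)
  case (Suc n)
  show ?case
  proof (cases "n \<ge> 1")
    case True
    then show ?thesis using Suc.prems
    proof (induction x rule: J_Suc_induct)
      case (mult b c)
      then have "(b * a) * c \<in> J (Suc n)" using Suc.IH J_mult_I by blast
      then show ?case by (simp add: ac_simps)
    next
      case (nsmul b)
      then show ?case using Suc.IH J_nsmul by (simp add: nsmul_mult_right)
    next
      case (diff x y)
      then show ?case using add_subgroupD(2)[OF add_subgroup_J] by (simp add: left_diff_distrib)
    qed
  next
    case False
    then have "n = 0" by simp
    then show ?thesis using Suc.prems rng_idealD(2)[OF ideal] by simp
  qed
qed simp

lemma rng_ideal_J: "rng_ideal (J n)"
  using add_subgroup_J J_mult_right by (auto simp: rng_ideal_def)

lemmas J_zero = add_subgroupD(1)[OF add_subgroup_J]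
  and J_diff = add_subgroupD(2)[OF add_subgroup_J]
  and J_minus = add_subgroupD(3)[OF add_subgroup_J]
  and J_add = add_subgroupD(4)[OF add_subgroup_J]

lemma J_Suc_subset: "J (Suc n) \<subseteq> J n"
proof
  fix x assume x: "x \<in> J (Suc n)"
  show "x \<in> J n"
  proof (cases "n \<ge> 1")
    case True
    then show ?thesis using x
    proof (induction x rule: J_Suc_induct)
      case (nsmul a)
      then show ?case by (rule add_subgroup_nsmul[OF add_subgroup_J])
    qed (auto intro: J_mult_right J_diff)
  next
    case False
    then have "n = 0" by simp
    then show ?thesis by simp
  qed
qed

lemma J_antimono: "m \<le> n \<Longrightarrow> J n \<subseteq> J m"
  by (rule lift_Suc_antimono_le[of J]) (rule J_Suc_subset)

lemma J_mult: "a \<in> J m \<Longrightarrow> b \<in> J n \<Longrightarrow> a * b \<in> J (m + n)"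
proof (induction n arbitrary: b)
  case 0
  then show ?case using J_mult_right by simp
next
  case (Suc n)
  show ?case
  proof (cases "n \<ge> 1")
    case True
    then show ?thesis using Suc.prems(2)
    proof (induction b rule: J_Suc_induct)
      case (mult c d)
      then have "(a * c) * d \<in> J (Suc (m + n))" using Suc J_mult_I by blast
      then show ?case by (simp add: ac_simps)
    next
      case (nsmul c)
      then show ?case using Suc J_nsmul by (simp add: nsmul_mult_left)
    next
      case (diff x y)
      then show ?case using J_diff by (simp add: right_diff_distrib)
    qed
  next
    case False
    then have "n = 0" by simp
    then show ?thesis using Suc.prems J_mult_I by simp
  qed
qed

lemma J_rpow: "a \<in> J k \<Longrightarrow> m \<ge> 1 \<Longrightarrow> rpow a m \<in> J (k * m)"
  by (rotate_tac, induction m rule: dec_induct)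
     (auto simp: rpow_Suc add.commute dest: J_mult[of _ _ a k])

lemma J_nsmul_power: "a \<in> J n \<Longrightarrow> nsmul (p ^ k) a \<in> J (n + k)"
  by (induction k) (auto simp: nsmul_power_Suc simp del: power_Suc intro: J_nsmul)

lemma P_subset_J: "P k \<subseteq> J k"
  using J_nsmul_power[of _ 0 k] by auto

lemma rng_ideal_P: "rng_ideal (P k)"
  by (rule rng_ideal_multiples)

lemmas P_zero = add_subgroupD(1)[OF rng_idealD(1)[OF rng_ideal_P]]
  and P_diff = add_subgroupD(2)[OF rng_idealD(1)[OF rng_ideal_P]]

lemma hom_J_subset:
  assumes "rng_hom h" "\<And>a. a \<in> I \<Longrightarrow> h a \<in> I" "x \<in> J n"
  shows "h x \<in> J n"
  using assms(3)
proof (induction n arbitrary: x)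
  case (Suc n)
  show ?case
  proof (cases "n \<ge> 1")
    case True
    then show ?thesis using Suc.prems
      by (induction x rule: J_Suc_induct)
         (auto simp: rng_homD[OF assms(1)] rng_hom_diff[OF assms(1)] rng_hom_nsmul[OF assms(1)]
           intro: J_mult_I J_nsmul J_diff Suc.IH assms(2))
  next
    case False
    then have "n = 0" by simp
    then show ?thesis using Suc.prems assms(2) by simp
  qed
qed simp

lemma hom_inv: "rng_hom (inv \<phi>)"
  unfolding rng_hom_def
proof safe
  fix x y
  have s: "\<phi> (inv \<phi> z) = z" for z using bij by (simp add: bij_is_surj surj_f_inv_f)
  show "inv \<phi> (x + y) = inv \<phi> x + inv \<phi> y" "inv \<phi> (x * y) = inv \<phi> x * inv \<phi> y"
    by (rule injD[OF bij_is_inj[OF bij]], simp add: s rng_homD[OF hom])+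
qed

lemma phi_J_iff: "\<phi> a \<in> J n \<longleftrightarrow> a \<in> J n"
proof
  have "inv \<phi> b \<in> I" if "b \<in> I" for b
    using that phi_mem_iff[of "inv \<phi> b"] bij by (simp add: bij_is_surj surj_f_inv_f)
  then have "\<phi> a \<in> J n \<Longrightarrow> inv \<phi> (\<phi> a) \<in> J n" by (rule hom_J_subset[OF hom_inv])
  then show "\<phi> a \<in> J n \<Longrightarrow> a \<in> J n" by (simp add: bij_is_inj[OF bij])
next
  show "a \<in> J n \<Longrightarrow> \<phi> a \<in> J n"
    by (rule hom_J_subset[OF hom]) (simp_all add: phi_mem_iff)
qed

lemma phi_funpow_J_iff: "(\<phi> ^^ k) a \<in> J n \<longleftrightarrow> a \<in> J n"
  by (induction k) (simp_all add: phi_J_iff)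

text \<open>
  With \<open>\<delta>(x) = (\<phi>(x) - x\<^sup>p) / p\<close> this says \<open>\<delta>(I\<^sup>n\<^sup>+\<^sup>1) \<subseteq> I\<^sup>n\<close>: the operator \<open>\<delta>\<close> is a derivation up to
  Frobenius twists and higher order terms, and so it lowers the order of vanishing by at most one.
\<close>

lemma Frobenius_defect:
  "x \<in> J (Suc n) \<Longrightarrow> \<exists>d\<in>J n. \<phi> x = rpow x p + nsmul p d"
proof (induction n arbitrary: x)
  case 0
  obtain d where "\<phi> x - rpow x p = nsmul p d" using lift by (auto simp: lifts_Frobenius_def)
  then have "\<phi> x = rpow x p + nsmul p d" by (simp add: algebra_simps)
  then show ?case by auto
next
  case (Suc n)
  have "Suc n \<ge> 1" by simp
  then show ?case using Suc.prems
  proof (induction x rule: J_Suc_induct)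
    case (mult a b)
    obtain d where d: "d \<in> J n" "\<phi> a = rpow a p + nsmul p d" using Suc.IH[OF mult(1)] by blast
    obtain e where "\<phi> b - rpow b p = nsmul p e" using lift by (auto simp: lifts_Frobenius_def)
    then have e: "\<phi> b = rpow b p + nsmul p e" by (simp add: algebra_simps)
    let ?c = "rpow a p * e + d * rpow b p + nsmul p (d * e)"
    have "rpow (a * b) p = rpow a p * rpow b p"
      using p_ge_1 by (induction p rule: dec_induct) (simp_all add: rpow_Suc ac_simps)
    then have "\<phi> (a * b) = rpow (a * b) p + nsmul p ?c"
      by (simp add: rng_homD[OF hom] d(2) e distrib_left distrib_right nsmul_add
          nsmul_mult_left nsmul_mult_right ac_simps)
    moreover have "?c \<in> J (Suc n)"
    proof (intro J_add)
      show "rpow a p * e \<in> J (Suc n)"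
        using rng_ideal_rpow[OF rng_ideal_J mult(1) p_ge_1] by (rule J_mult_right)
      show "d * rpow b p \<in> J (Suc n)"
        using d(1) rng_ideal_rpow[OF ideal mult(2) p_ge_1] by (rule J_mult_I)
      show "nsmul p (d * e) \<in> J (Suc n)" using d(1) by (intro J_nsmul J_mult_right)
    qed
    ultimately show ?case by blast
  next
    case (nsmul a)
    let ?c = "\<phi> a - nsmul (p ^ (p - 1)) (rpow a p)"
    have "p ^ p = p * p ^ (p - 1)" using p_ge_1 by (cases p) auto
    then have "\<phi> (nsmul p a) = rpow (nsmul p a) p + nsmul p ?c"
      using p_ge_1 by (simp add: rng_hom_nsmul[OF hom] rpow_nsmul nsmul_diff nsmul_nsmul)
    moreover have "?c \<in> J (Suc n)"
      using nsmul p_ge_1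
      by (intro J_diff add_subgroup_nsmul[OF add_subgroup_J] rng_ideal_rpow[OF rng_ideal_J])
         (simp_all add: phi_J_iff)
    ultimately show ?case by blast
  next
    case (diff x y)
    obtain d e where d: "d \<in> J (Suc n)" "\<phi> x = rpow x p + nsmul p d"
      and e: "e \<in> J (Suc n)" "\<phi> y = rpow y p + nsmul p e"
      using diff by blast
    obtain c where c: "c \<in> J (Suc (Suc n))" "rpow ((x - y) + y) p = rpow (x - y) p + rpow y p + nsmul p c"
      using prime_rpow_add[OF p rng_ideal_J diff(2)] by blast
    then have "\<phi> (x - y) = rpow (x - y) p + nsmul p (c + d - e)"
      by (simp add: rng_hom_diff[OF hom] d(2) e(2) nsmul_diff nsmul_add algebra_simps)
    moreover have "c + d - e \<in> J (Suc n)"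
      using c(1) d(1) e(1) subsetD[OF J_Suc_subset] by (intro J_diff J_add) blast+
    ultimately show ?case by blast
  qed
qed

text \<open>
  Strictness of the filtration: the factor \<open>p\<^sup>n\<close> accounts for exactly \<open>n\<close> of the \<open>n + 1\<close> orders of
  vanishing. Each application of \<open>\<delta>\<close> strips one factor \<open>p\<close>, as \<open>\<delta>(p\<^sup>nb)\<close> equals \<open>p\<^sup>n\<^sup>-\<^sup>1\<phi>(b)\<close>
  up to a multiple of \<open>p\<^sup>n\<close>.
\<close>

lemma nsmul_power_in_J_SucD: "nsmul (p ^ n) b \<in> J (Suc n) \<Longrightarrow> b \<in> I"
proof (induction n arbitrary: b)
  case 0
  then show ?case by simp
next
  case (Suc n)
  let ?x = "nsmul (p ^ Suc n) b"
  obtain d where d: "d \<in> J (Suc n)" "\<phi> ?x = rpow ?x p + nsmul p d"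
    using Frobenius_defect[OF Suc.prems] by blast
  \<comment> \<open>As \<open>p \<ge> 2\<close>, the \<open>p\<close>-th power of \<open>?x\<close> is divisible by one more factor \<open>p\<close> than \<open>?x\<close>.\<close>
  obtain q where q: "Suc n * p = Suc (Suc n + q)"
  proof -
    have "Suc n * 2 \<le> Suc n * p" using prime_ge_2_nat[OF p] by (rule mult_le_mono2)
    then have "Suc (Suc n + (Suc n * p - Suc (Suc n))) = Suc n * p" by simp
    then show ?thesis using that[OF sym] by blast
  qed
  have "rpow ?x p = nsmul (p ^ (Suc n * p)) (rpow b p)"
    using p_ge_1 by (simp only: rpow_nsmul power_mult)
  also have "\<dots> = nsmul p (nsmul (p ^ Suc n) (nsmul (p ^ q) (rpow b p)))"
    unfolding q by (simp add: nsmul_nsmul power_add ac_simps)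
  finally have "nsmul p (nsmul (p ^ n) (\<phi> b))
      = nsmul p (nsmul (p ^ Suc n) (nsmul (p ^ q) (rpow b p)) + d)"
    using d(2) by (simp add: rng_hom_nsmul[OF hom] nsmul_power_Suc nsmul_add del: power_Suc)
  then have "nsmul (p ^ n) (\<phi> b) = nsmul (p ^ Suc n) (nsmul (p ^ q) (rpow b p)) + d"
    by (rule torsion_cancel)
  also have "\<dots> \<in> J (Suc n)" using d(1) subsetD[OF P_subset_J rangeI] by (intro J_add)
  finally have "\<phi> b \<in> I" by (rule Suc.IH)
  then show ?case by (simp add: phi_mem_iff)
qed

lemma rpow_cong_J: "x - y \<in> I \<Longrightarrow> rpow x (p ^ k) - rpow y (p ^ k) \<in> J (Suc k)"
proof (rule rpow_prime_power_cong[OF p, of J])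
  fix m z assume m: "m \<ge> 1" "z \<in> J m"
  have "Suc m \<le> m * 2" using m(1) by simp
  also have "\<dots> \<le> m * p" using prime_ge_2_nat[OF p] by simp
  finally show "rpow z p \<in> J (Suc m)" using J_rpow[OF m(2) p_ge_1] J_antimono by blast
qed (simp_all add: rng_ideal_J J_nsmul)

lemma rpow_cong_P: "x - y \<in> P 1 \<Longrightarrow> rpow x (p ^ k) - rpow y (p ^ k) \<in> P (Suc k)"
proof (rule rpow_prime_power_cong[OF p, of P])
  fix m z assume m: "m \<ge> 1" "z \<in> P m"
  then obtain b where z: "z = nsmul (p ^ m) b" by auto
  have "Suc m \<le> m * 2" using m(1) by simp
  also have "\<dots> \<le> m * p" using prime_ge_2_nat[OF p] by simp
  finally obtain q where "m * p = Suc m + q" using le_Suc_ex by blast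
  then have "rpow z p = nsmul (p ^ Suc m) (nsmul (p ^ q) (rpow b p))"
    unfolding z using p_ge_1
    by (simp add: rpow_nsmul nsmul_nsmul power_add ac_simps flip: power_mult)
  then show "rpow z p \<in> P (Suc m)" by blast
qed (auto simp: rng_ideal_P nsmul_nsmul)


section \<open>Dwork sequences\<close>

text \<open>
  Dwork's congruences cut out \<open>X(A)\<close>. The conditions \<open>K\<close> on the single components serve to single
  out \<open>X(I)\<close> as well, so that both groups are treated by the same argument.
\<close>

definition dwork :: "(nat \<Rightarrow> 'a set) \<Rightarrow> enat \<Rightarrow> (nat \<Rightarrow> 'a) set" where
  "dwork K N = {s \<in> seqs N.
     (\<forall>\<nu>. enat (Suc \<nu>) < N \<longrightarrow> s (Suc \<nu>) - \<phi> (s \<nu>) \<in> P (Suc \<nu>)) \<and>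
     (\<forall>\<nu>. enat \<nu> < N \<longrightarrow> s \<nu> \<in> K \<nu>)}"

text \<open>
  What is needed of \<open>K\<close> for it to describe the sequences with Witt coordinates in \<open>L\<close>: these
  sequences satisfy \<open>K\<close>, and if a sequence satisfying \<open>K\<close> starts with \<open>p\<^sup>\<nu>b\<close> at the index \<open>\<nu>\<close>, then
  \<open>b\<close> is an admissible coordinate.
\<close>

definition detects :: "(nat \<Rightarrow> 'a set) \<Rightarrow> 'a set \<Rightarrow> bool" where
  "detects K L \<longleftrightarrow> (\<forall>\<nu>. add_subgroup (K \<nu>)) \<and>
     (\<forall>\<mu> k. \<forall>a\<in>L. nsmul (p ^ \<mu>) (rpow a (p ^ k)) \<in> K (\<mu> + k)) \<and>
     (\<forall>\<nu> b. nsmul (p ^ \<nu>) b \<in> K \<nu> \<longrightarrow> b \<in> L)"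

lemma detects_UNIV: "detects (\<lambda>_. UNIV) UNIV"
  by (simp add: detects_def add_subgroup_def)

lemma detects_I: "detects (\<lambda>\<nu>. J (Suc \<nu>)) I"
  unfolding detects_def
proof (intro conjI allI ballI impI)
  fix \<mu> k a assume "a \<in> I"
  then have "rpow a (p ^ k) \<in> J (p ^ k)"
    using J_rpow[of a 1 "p ^ k"] p_power_ge_1 by simp
  then have "rpow a (p ^ k) \<in> J (Suc k)"
    using J_antimono[OF Suc_le_p_power] by blast
  then have "nsmul (p ^ \<mu>) (rpow a (p ^ k)) \<in> J (Suc k + \<mu>)" by (rule J_nsmul_power)
  then show "nsmul (p ^ \<mu>) (rpow a (p ^ k)) \<in> J (Suc (\<mu> + k))" by (simp add: add.commute)
qed (rule add_subgroup_J, rule nsmul_power_in_J_SucD)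

lemma dworkI:
  assumes "\<And>\<nu>. N \<le> enat \<nu> \<Longrightarrow> s \<nu> = 0"
    and "\<And>\<nu>. enat (Suc \<nu>) < N \<Longrightarrow> s (Suc \<nu>) - \<phi> (s \<nu>) \<in> P (Suc \<nu>)"
    and "\<And>\<nu>. enat \<nu> < N \<Longrightarrow> s \<nu> \<in> K \<nu>"
  shows "s \<in> dwork K N"
  using assms by (simp add: dwork_def seqs_def)

lemma dworkD:
  assumes "s \<in> dwork K N"
  shows "N \<le> enat \<nu> \<Longrightarrow> s \<nu> = 0"
    and "enat (Suc \<nu>) < N \<Longrightarrow> s (Suc \<nu>) - \<phi> (s \<nu>) \<in> P (Suc \<nu>)"
    and "enat \<nu> < N \<Longrightarrow> s \<nu> \<in> K \<nu>"
  using assms by (simp_all add: dwork_def seqs_def)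

lemma dwork_subset_seqs: "dwork K N \<subseteq> seqs N"
  by (auto simp: dwork_def)

lemma add_subgroup_dwork:
  assumes "\<And>\<nu>. add_subgroup (K \<nu>)"
  shows "add_subgroup (dwork K N)"
  unfolding add_subgroup_def
proof (intro conjI ballI)
  show "0 \<in> dwork K N"
    using P_zero add_subgroupD(1)[OF assms]
    by (intro dworkI) (simp_all add: rng_hom_zero[OF hom] del: power_Suc)
next
  fix s t assume s: "s \<in> dwork K N" and t: "t \<in> dwork K N"
  show "s - t \<in> dwork K N"
  proof (rule dworkI)
    fix \<nu> assume \<nu>: "enat (Suc \<nu>) < N"
    have "(s (Suc \<nu>) - \<phi> (s \<nu>)) - (t (Suc \<nu>) - \<phi> (t \<nu>)) \<in> P (Suc \<nu>)"
      using dworkD(2)[OF s \<nu>] dworkD(2)[OF t \<nu>] by (rule P_diff)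
    then show "(s - t) (Suc \<nu>) - \<phi> ((s - t) \<nu>) \<in> P (Suc \<nu>)"
      by (simp only: minus_apply rng_hom_diff[OF hom] algebra_simps)
  qed (use dworkD[OF s] dworkD[OF t] add_subgroupD(2)[OF assms] in auto)
qed

text \<open>
  Dwork's congruences for \<open>V\<^sup>\<mu>\<langle>a\<rangle>\<close>: raising \<open>a\<^sup>p \<equiv> \<phi>(a)\<close> modulo \<open>p\<close> to the \<open>p\<^sup>k\<close>-th power gives a
  congruence modulo \<open>p\<^sup>k\<^sup>+\<^sup>1\<close>, and the factor \<open>p\<^sup>\<mu>\<close> contributes the rest.
\<close>

lemma Vgen_in_dwork:
  assumes "detects K L" "a \<in> L"
  shows "Vgen p N \<mu> a \<in> dwork K N"
proof (rule dworkI)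
  fix \<nu> assume \<nu>: "enat (Suc \<nu>) < N"
  then have \<nu>': "enat \<nu> < N" using order.strict_trans[of "enat \<nu>" "enat (Suc \<nu>)" N] by simp
  consider "\<mu> \<le> \<nu>" | "\<mu> = Suc \<nu>" | "\<mu> > Suc \<nu>" by linarith
  then show "Vgen p N \<mu> a (Suc \<nu>) - \<phi> (Vgen p N \<mu> a \<nu>) \<in> P (Suc \<nu>)"
  proof cases
    case 1
    define k where "k = \<nu> - \<mu>"
    have k: "\<nu> = \<mu> + k" using 1 by (simp add: k_def)
    obtain b where "\<phi> a - rpow a p = nsmul p b" using lift by (auto simp: lifts_Frobenius_def)
    then have "rpow a p - \<phi> a = nsmul (p ^ 1) (- b)"
      using nsmul_diff[of p 0 b] minus_diff_eq[of "\<phi> a" "rpow a p"] by simp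
    then have "rpow a p - \<phi> a \<in> P 1" by (metis rangeI)
    then have "rpow (rpow a p) (p ^ k) - rpow (\<phi> a) (p ^ k) \<in> P (Suc k)" by (rule rpow_cong_P)
    then obtain c where c: "rpow (rpow a p) (p ^ k) - rpow (\<phi> a) (p ^ k) = nsmul (p ^ Suc k) c" by blast
    have "Vgen p N \<mu> a (Suc \<nu>) - \<phi> (Vgen p N \<mu> a \<nu>)
        = nsmul (p ^ \<mu>) (rpow (rpow a p) (p ^ k) - rpow (\<phi> a) (p ^ k))"
      using \<nu> \<nu>' p_ge_1 p_power_ge_1[of k]
      by (simp add: Vgen_def k Suc_diff_le nsmul_diff rpow_rpow rng_hom_nsmul[OF hom] rng_hom_rpow[OF hom])
    also have "\<dots> = nsmul (p ^ Suc \<nu>) c"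
      unfolding c nsmul_nsmul k by (simp add: power_add ac_simps)
    finally show ?thesis by blast
  next
    case 2
    then show ?thesis using \<nu> by (simp add: Vgen_def rng_hom_zero[OF hom])
  next
    case 3
    then show ?thesis using P_zero by (simp add: Vgen_def rng_hom_zero[OF hom] del: power_Suc)
  qed
next
  fix \<nu> assume "enat \<nu> < N"
  then show "Vgen p N \<mu> a \<nu> \<in> K \<nu>"
    using assms add_subgroupD(1)[of "K \<nu>"] unfolding detects_def Vgen_def
    by (cases "\<mu> \<le> \<nu>") (metis le_add_diff_inverse, simp)
qed (auto simp: Vgen_def)

text \<open>
  Successive approximation: if a Dwork sequence vanishes before the index \<open>n\<close>, then its \<open>n\<close>-th
  component is \<open>p\<^sup>nb\<close> for some \<open>b\<close>, and subtracting \<open>V\<^sup>n\<langle>b\<rangle>\<close> kills this component too.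
\<close>

lemma dwork_approximation:
  assumes KL: "detects K L" and H: "add_subgroup H"
    and gen: "\<And>\<mu> a. enat \<mu> < N \<Longrightarrow> a \<in> L \<Longrightarrow> Vgen p N \<mu> a \<in> H"
    and s: "s \<in> dwork K N"
  shows "\<exists>h \<in> H \<inter> dwork K N. \<forall>\<nu><n. h \<nu> = s \<nu>"
proof (induction n)
  have K: "add_subgroup (K \<nu>)" for \<nu> using KL by (simp add: detects_def)
  case 0
  show ?case using add_subgroupD(1)[OF H] add_subgroupD(1)[OF add_subgroup_dwork[of K, OF K]] by auto
next
  have K: "add_subgroup (K \<nu>)" for \<nu> using KL by (simp add: detects_def)
  note dwork_diff = add_subgroupD(2)[OF add_subgroup_dwork[of K, OF K]]
    and dwork_add = add_subgroupD(4)[OF add_subgroup_dwork[of K, OF K]]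
  case (Suc n)
  then obtain h where h: "h \<in> H" "h \<in> dwork K N" "\<And>\<nu>. \<nu> < n \<Longrightarrow> h \<nu> = s \<nu>" by blast
  show ?case
  proof (cases "enat n < N")
    case True
    define t where "t = s - h"
    have t: "t \<in> dwork K N" unfolding t_def using s h(2) by (rule dwork_diff)
    have "t n \<in> P n"
    proof (cases n)
      case 0
      then show ?thesis by simp
    next
      case (Suc m)
      then have "t m = 0" using h(3) by (simp add: t_def)
      then show ?thesis using dworkD(2)[OF t, of m] True Suc by (simp add: rng_hom_zero[OF hom])
    qed
    then obtain b where b: "t n = nsmul (p ^ n) b" by blast
    then have bL: "b \<in> L" using dworkD(3)[OF t True] KL by (auto simp: detects_def)
    let ?h = "h + Vgen p N n b"
    have "?h \<in> H \<inter> dwork K N"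
      using h gen[OF True bL] Vgen_in_dwork[OF KL bL] add_subgroupD(4)[OF H] dwork_add by simp
    moreover have "?h \<nu> = s \<nu>" if "\<nu> < Suc n" for \<nu>
      using that h(3) b True
      by (cases "\<nu> = n") (simp_all add: Vgen_def t_def algebra_simps)
    ultimately show ?thesis by blast
  next
    case False
    then have "h n = s n" using dworkD(1)[OF s] dworkD(1)[OF h(2)] by simp
    then show ?thesis using h by (auto simp: less_Suc_eq)
  qed
qed

lemma dwork_finite_generated:
  assumes "detects K L" "add_subgroup H"
    and "\<And>\<mu> a. \<mu> < n \<Longrightarrow> a \<in> L \<Longrightarrow> Vgen p (enat n) \<mu> a \<in> H"
    and s: "s \<in> dwork K (enat n)"
  shows "s \<in> H"
proof -
  obtain h where h: "h \<in> H" "h \<in> dwork K (enat n)" "\<forall>\<nu><n. h \<nu> = s \<nu>"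
    using dwork_approximation[OF assms(1,2) _ s, of n] assms(3) by auto
  have "h \<nu> = s \<nu>" for \<nu>
    using h(3) dworkD(1)[OF s, of \<nu>] dworkD(1)[OF h(2), of \<nu>] by (cases "\<nu> < n") auto
  then show ?thesis using h(1) by (metis ext)
qed

lemma closedin_dwork: "closedin (seq_top N) (dwork K N)"
  unfolding closedin_seq_top
proof (intro conjI ballI impI)
  fix s assume s: "s \<in> seqs N" and approx: "\<forall>n. \<exists>h\<in>dwork K N. \<forall>\<nu><n. h \<nu> = s \<nu>"
  show "s \<in> dwork K N"
  proof (rule dworkI)
    fix \<nu> assume \<nu>: "enat (Suc \<nu>) < N"
    obtain h where h: "h \<in> dwork K N" "\<forall>i<Suc (Suc \<nu>). h i = s i" using approx by blast
    then have "h \<nu> = s \<nu>" "h (Suc \<nu>) = s (Suc \<nu>)" by auto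
    then show "s (Suc \<nu>) - \<phi> (s \<nu>) \<in> P (Suc \<nu>)" using dworkD(2)[OF h(1) \<nu>] by metis
  next
    fix \<nu> assume \<nu>: "enat \<nu> < N"
    obtain h where h: "h \<in> dwork K N" "\<forall>i<Suc \<nu>. h i = s i" using approx by blast
    then have "h \<nu> = s \<nu>" by auto
    then show "s \<nu> \<in> K \<nu>" using dworkD(3)[OF h(1) \<nu>] by metis
  qed (use s in \<open>simp add: seqs_def\<close>)
qed (rule dwork_subset_seqs)

text \<open>
  The Dwork sequences form a closed group that contains the generators, and by approximation every
  closed group that contains the generators contains all of them. For \<open>L = UNIV\<close> this is Dwork's
  lemma.
\<close>

theorem X_eq_dwork:
  assumes KL: "detects K L"
  shows "X p N L = dwork K N"
proof (rule antisym)
  have K: "add_subgroup (K \<nu>)" for \<nu> using KL by (simp add: detects_def)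
  show "X p N L \<subseteq> dwork K N"
    unfolding X_def
  proof (rule hull_minimal)
    show "{Vgen p N \<mu> a |\<mu> a. enat \<mu> < N \<and> a \<in> L} \<subseteq> dwork K N"
      using Vgen_in_dwork[OF KL] by blast
    show "closedin (seq_top N) (dwork K N) \<and> add_subgroup (dwork K N)"
      using closedin_dwork add_subgroup_dwork[of K, OF K] by blast
  qed
  show "dwork K N \<subseteq> X p N L"
    unfolding X_def hull_def
  proof safe
    fix s H
    assume s: "s \<in> dwork K N" and gen: "{Vgen p N \<mu> a |\<mu> a. enat \<mu> < N \<and> a \<in> L} \<subseteq> H"
      and H: "closedin (seq_top N) H" "add_subgroup H"
    have "\<exists>h\<in>H. \<forall>\<nu><n. h \<nu> = s \<nu>" for n
      using dwork_approximation[OF KL H(2) _ s, of n] gen by blast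
    then show "s \<in> H"
      using H(1) s dwork_subset_seqs unfolding closedin_seq_top by blast
  qed
qed

abbreviation D :: "enat \<Rightarrow> (nat \<Rightarrow> 'a) set" where
  "D \<equiv> dwork (\<lambda>_. UNIV)"

abbreviation DI :: "enat \<Rightarrow> (nat \<Rightarrow> 'a) set" where
  "DI \<equiv> dwork (\<lambda>\<nu>. J (Suc \<nu>))"

lemmas X_UNIV_eq = X_eq_dwork[OF detects_UNIV]
  and X_I_eq = X_eq_dwork[OF detects_I]


lemma add_subgroup_DI: "add_subgroup (DI N)"
  by (rule add_subgroup_dwork) (rule add_subgroup_J)

lemma coset_J_iff: "a +o J n = b +o J n \<longleftrightarrow> a - b \<in> J n"
  by (rule coset_eq_iff[OF add_subgroup_J])

lemma coset_DI_iff: "s +o DI N = t +o DI N \<longleftrightarrow> s - t \<in> DI N"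
  by (rule coset_eq_iff[OF add_subgroup_DI])

lemma add_subgroup_D: "add_subgroup (D N)"
  by (rule add_subgroup_dwork) (simp add: add_subgroup_def)

lemmas DI_zero = add_subgroupD(1)[OF add_subgroup_DI]
  and DI_diff = add_subgroupD(2)[OF add_subgroup_DI]
  and DI_add = add_subgroupD(4)[OF add_subgroup_DI]
  and D_diff = add_subgroupD(2)[OF add_subgroup_D]
  and D_add = add_subgroupD(4)[OF add_subgroup_D]

lemma DI_subset_D: "DI N \<subseteq> D N"
  by (auto simp: dwork_def)

lemma DI_iff: "s \<in> DI N \<longleftrightarrow> s \<in> D N \<and> (\<forall>\<nu>. enat \<nu> < N \<longrightarrow> s \<nu> \<in> J (Suc \<nu>))"
  by (auto simp: dwork_def)

lemma D_mult: "s * t \<in> D N" if s: "s \<in> D N" and t: "t \<in> D N"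
proof (rule dworkI)
  fix \<nu> assume \<nu>: "enat (Suc \<nu>) < N"
  have "(s (Suc \<nu>) - \<phi> (s \<nu>)) * t (Suc \<nu>) + \<phi> (s \<nu>) * (t (Suc \<nu>) - \<phi> (t \<nu>)) \<in> P (Suc \<nu>)"
    using dworkD(2)[OF s \<nu>] dworkD(2)[OF t \<nu>]
    by (intro add_subgroupD(4)[OF rng_idealD(1)[OF rng_ideal_P]] rng_idealD(2,3)[OF rng_ideal_P])
  then show "(s * t) (Suc \<nu>) - \<phi> ((s * t) \<nu>) \<in> P (Suc \<nu>)"
    by (simp add: rng_homD[OF hom] algebra_simps del: power_Suc)
qed (use dworkD(1)[OF s] in auto)

lemma ideal_in_D: "ideal_in (D N) (DI N)"
  unfolding ideal_in_def
proof (intro conjI ballI add_subgroup_DI DI_subset_D)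
  fix x y assume "x \<in> DI N" "y \<in> D N"
  then show "x * y \<in> DI N" using D_mult J_mult_right unfolding DI_iff by auto
qed

lemma ideal_in_J: "ideal_in UNIV (J n)"
  using add_subgroup_J J_mult_right by (auto simp: ideal_in_def)

lemma E_eq: "E p N I = quot (D N) (DI N)"
  by (simp add: E_def X_UNIV_eq X_I_eq)

lemma carr_Quot_pow: "carr (Quot_pow p I n) = range (\<lambda>a. a +o J n)"
  by (simp add: Quot_pow_def carr_quot)

lemma carr_E: "carr (E p N I) = (\<lambda>s. s +o DI N) ` D N"
  by (simp add: E_eq carr_quot)

text \<open>
  For Dwork sequences of finite length the conditions on all components follow from the one on the
  last component, as \<open>\<phi>\<close> maps each component to the next one modulo \<open>p\<^sup>\<nu>\<^sup>+\<^sup>1A \<subseteq> I\<^sup>\<nu>\<^sup>+\<^sup>1\<close> and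
  \<open>\<phi>(x) \<in> I\<^sup>\<nu>\<^sup>+\<^sup>1\<close> implies \<open>x \<in> I\<^sup>\<nu>\<^sup>+\<^sup>1\<close>.
\<close>

lemma DI_if_last_component:
  assumes t: "t \<in> D (enat (Suc n))" and last: "t n \<in> J (Suc n)"
  shows "t \<in> DI (enat (Suc n))"
proof -
  have "t \<nu> \<in> J (Suc \<nu>)" if "\<nu> \<le> n" for \<nu>
    using that
  proof (induction rule: inc_induct)
    case (step \<nu>)
    have "t (Suc \<nu>) - \<phi> (t \<nu>) \<in> J (Suc \<nu>)"
      using dworkD(2)[OF t, of \<nu>] step(2) subsetD[OF P_subset_J] by (simp del: power_Suc)
    moreover have "t (Suc \<nu>) \<in> J (Suc \<nu>)" using step.IH J_Suc_subset by blast
    ultimately have "t (Suc \<nu>) - (t (Suc \<nu>) - \<phi> (t \<nu>)) \<in> J (Suc \<nu>)" by (rule J_diff[rotated])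
    then show ?case by (simp add: phi_J_iff)
  qed (rule last)
  then show ?thesis using t by (simp add: DI_iff)
qed

lemma trunc_simps:
  "trunc n (s + t) = trunc n s + trunc n t" "trunc n (s - t) = trunc n s - trunc n t"
  "trunc n (s * t) = trunc n s * trunc n t" for s t :: "nat \<Rightarrow> 'b::comm_ring"
  by (auto simp: trunc_def)

lemma trunc_in_dwork: "s \<in> dwork K \<infinity> \<Longrightarrow> trunc n s \<in> dwork K (enat n)"
  by (rule dworkI) (auto simp: trunc_def dworkD simp del: power_Suc)

text \<open>
  The image of \<open>X(I) \<rightarrow> X\<^sub>n(I)\<close> is a group that contains the generators \<open>V\<^sup>\<mu>\<langle>a\<rangle>\<close>.
\<close>

lemma trunc_surj_DI:
  assumes "t \<in> DI (enat n)"
  shows "\<exists>u\<in>DI \<infinity>. trunc n u = t"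
proof -
  have "t \<in> trunc n ` DI \<infinity>"
  proof (rule dwork_finite_generated[OF detects_I _ _ assms])
    show "add_subgroup (trunc n ` DI \<infinity>)"
      unfolding add_subgroup_def
    proof (intro conjI ballI)
      have "0 = trunc n (0 :: nat \<Rightarrow> 'a)" by (auto simp: trunc_def)
      then show "0 \<in> trunc n ` DI \<infinity>" using DI_zero by (rule image_eqI)
    qed (use DI_diff in \<open>auto simp flip: trunc_simps\<close>)
  next
    fix \<mu> a assume "a \<in> I"
    moreover have "Vgen p (enat n) \<mu> a = trunc n (Vgen p \<infinity> \<mu> a)"
      by (auto simp: Vgen_def trunc_def)
    ultimately show "Vgen p (enat n) \<mu> a \<in> trunc n ` DI \<infinity>"
      using Vgen_in_dwork[OF detects_I] by blast
  qed
  then show ?thesis by auto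
qed

section \<open>The comparison maps at finite level\<close>

definition orbit :: "'a \<Rightarrow> nat \<Rightarrow> 'a" where
  "orbit a = (\<lambda>\<nu>. (\<phi> ^^ \<nu>) a)"

lemma hom_funpow: "rng_hom (\<phi> ^^ k)"
  by (induction k) (use hom in \<open>auto simp: rng_hom_def\<close>)

lemma orbit_simps:
  "orbit (a + b) = orbit a + orbit b" "orbit (a - b) = orbit a - orbit b"
  "orbit (a * b) = orbit a * orbit b"
  by (auto simp: orbit_def rng_homD[OF hom_funpow] rng_hom_diff[OF hom_funpow])

lemma orbit_in_D: "orbit a \<in> D \<infinity>"
  using P_zero by (intro dworkI) (auto simp: orbit_def simp del: power_Suc)

lemma trunc_orbit_in_D: "trunc n (orbit a) \<in> D (enat n)"
  by (rule trunc_in_dwork) (rule orbit_in_D)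

lemma trunc_orbit_in_DI_iff:
  assumes "n \<ge> 1"
  shows "trunc n (orbit a) \<in> DI (enat n) \<longleftrightarrow> a \<in> J n"
proof -
  obtain m where n: "n = Suc m" using assms by (cases n) auto
  have last: "trunc n (orbit a) m \<in> J n \<longleftrightarrow> a \<in> J n"
    by (simp add: n trunc_def orbit_def phi_funpow_J_iff)
  show ?thesis
  proof
    assume "trunc n (orbit a) \<in> DI (enat n)"
    then show "a \<in> J n" using dworkD(3)[of "trunc n (orbit a)" "\<lambda>\<nu>. J (Suc \<nu>)" "enat n" m] last n by simp
  next
    assume "a \<in> J n"
    then show "trunc n (orbit a) \<in> DI (enat n)"
      using DI_if_last_component[of "trunc n (orbit a)" m] trunc_orbit_in_D last n by simp
  qed
qed

lemma E_proj_coset: "E_proj p I n (s +o DI \<infinity>) = trunc n s +o DI (enat n)"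
  unfolding E_proj_def X_I_eq
proof (rule induced_coset[OF add_subgroup_DI])
  fix j assume "j \<in> DI \<infinity>"
  then show "trunc n (s + j) +o DI (enat n) = trunc n s +o DI (enat n)"
    by (simp add: coset_DI_iff trunc_simps trunc_in_dwork)
qed

lemma alpha_n_coset:
  assumes "n \<ge> 1"
  shows "alpha_n p \<phi> I n (a +o J n) = trunc n (orbit a) +o DI (enat n)"
proof -
  have *: "E_proj p I n (alpha p \<phi> I b) = trunc n (orbit b) +o DI (enat n)" for b
    by (simp add: alpha_def X_I_eq E_proj_coset flip: orbit_def)
  show ?thesis
    unfolding alpha_n_def
    by (subst induced_coset[OF add_subgroup_J])
       (simp_all add: * coset_DI_iff orbit_simps trunc_simps trunc_orbit_in_DI_iff[OF assms])
qed

lemma G_ref_coset: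
  "G_ref p I n (s +o DI (enat n)) = (\<lambda>\<nu>\<in>{..<n}. s \<nu> +o J (\<nu> + 1))"
  unfolding G_ref_def
proof (rule induced_coset[OF add_subgroup_DI])
  fix j assume "j \<in> DI (enat n)"
  then have "j \<nu> \<in> J (Suc \<nu>)" if "\<nu> < n" for \<nu> using that by (simp add: DI_iff)
  then show "(\<lambda>\<nu>\<in>{..<n}. (s + j) \<nu> +o J (\<nu> + 1)) = (\<lambda>\<nu>\<in>{..<n}. s \<nu> +o J (\<nu> + 1))"
    by (intro restrict_ext) (simp add: coset_J_iff)
qed

lemma phi_quot_coset: "phi_quot p \<phi> I n (a +o J n) = \<phi> a +o J n"
  unfolding phi_quot_def
  by (subst induced_coset[OF add_subgroup_J])
     (simp_all add: coset_J_iff rng_homD[OF hom] phi_J_iff)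

lemma phi_quot_inv_coset: "phi_quot_inv p \<phi> I n (\<phi> a +o J n) = a +o J n"
proof -
  have "inj_on (phi_quot p \<phi> I n) (carr (Quot_pow p I n))"
    unfolding carr_Quot_pow
  proof (rule inj_onI, elim rangeE)
    fix C C' b c
    assume "phi_quot p \<phi> I n C = phi_quot p \<phi> I n C'" and C: "C = b +o J n" "C' = c +o J n"
    then have "\<phi> (b - c) \<in> J n"
      by (simp add: phi_quot_coset coset_J_iff rng_hom_diff[OF hom])
    then show "C = C'" by (simp add: C coset_J_iff phi_J_iff)
  qed
  then have "phi_quot_inv p \<phi> I n (phi_quot p \<phi> I n (a +o J n)) = a +o J n"
    unfolding phi_quot_inv_def by (rule inv_into_f_f) (simp add: carr_Quot_pow)
  then show ?thesis by (simp only: phi_quot_coset)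
qed

lemma phi_quot_inv_funpow_coset: "(phi_quot_inv p \<phi> I n ^^ k) ((\<phi> ^^ k) a +o J n) = a +o J n"
  by (induction k) (simp_all add: funpow_swap1[of "phi_quot_inv p \<phi> I n"] phi_quot_inv_coset)

text \<open>The map \<open>\<phi>\<^sup>1\<^sup>-\<^sup>n \<circ> proj\<^sub>n\<^sub>-\<^sub>1\<close> on representatives.\<close>

definition unorbit :: "(nat \<Rightarrow> 'a) \<Rightarrow> nat \<Rightarrow> 'a" where
  "unorbit s n = (inv \<phi> ^^ (n - 1)) (s (n - 1))"

lemma funpow_phi_inv: "(\<phi> ^^ k) ((inv \<phi> ^^ k) a) = a"
  by (induction k)
     (simp_all add: funpow_swap1[of \<phi>] surj_f_inv_f[OF bij_is_surj[OF bij]])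

lemma phi_funpow_unorbit: "(\<phi> ^^ (n - 1)) (unorbit s n) = s (n - 1)"
  by (simp add: unorbit_def funpow_phi_inv)

text \<open>
  Every class in \<open>E\<^sub>n(R)\<close> comes from the element of \<open>A\<close> whose orbit has the same last component.
\<close>

lemma coset_unorbit:
  assumes "n \<ge> 1" "s \<in> D (enat n)"
  shows "s - trunc n (orbit (unorbit s n)) \<in> DI (enat n)"
proof -
  obtain m where n: "n = Suc m" using assms by (cases n) auto
  have "s - trunc n (orbit (unorbit s n)) \<in> D (enat n)"
    using assms(2) trunc_orbit_in_D by (rule D_diff)
  moreover have "(s - trunc n (orbit (unorbit s n))) m = 0"
    using phi_funpow_unorbit[of n s] by (simp add: n trunc_def orbit_def)
  ultimately show ?thesis
    unfolding n using DI_if_last_component J_zero by metis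
qed

lemma alpha_n_unorbit:
  assumes "n \<ge> 1" "s \<in> D (enat n)"
  shows "alpha_n p \<phi> I n (unorbit s n +o J n) = s +o DI (enat n)"
proof -
  have "s +o DI (enat n) = trunc n (orbit (unorbit s n)) +o DI (enat n)"
    using coset_unorbit[OF assms] by (simp add: coset_DI_iff)
  then show ?thesis by (simp add: alpha_n_coset[OF assms(1)])
qed

lemma G_ref_inverse:
  assumes "n \<ge> 1"
  shows "(phi_quot_inv p \<phi> I n ^^ (n - 1)) (G_ref p I n (s +o DI (enat n)) (n - 1)) = unorbit s n +o J n"
proof -
  have "G_ref p I n (s +o DI (enat n)) (n - 1) = (\<phi> ^^ (n - 1)) (unorbit s n) +o J n"
    using assms unfolding phi_funpow_unorbit by (simp add: G_ref_coset)
  then show ?thesis by (simp only: phi_quot_inv_funpow_coset)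
qed

lemma unorbit_trunc_orbit: "n \<ge> 1 \<Longrightarrow> unorbit (trunc n (orbit a)) n = a"
proof -
  assume "n \<ge> 1"
  then have "(\<phi> ^^ (n - 1)) (unorbit (trunc n (orbit a)) n) = (\<phi> ^^ (n - 1)) a"
    unfolding phi_funpow_unorbit by (simp add: trunc_def orbit_def)
  then show ?thesis using bij_fn[OF bij] by (metis bij_is_inj injD)
qed

theorem alpha_n_iso:
  assumes n: "n \<ge> 1"
  shows "alpha_n p \<phi> I n \<in> rng_isos (Quot_pow p I n) (E p (enat n) I)"
proof -
  have "alpha_n p \<phi> I n \<in> rng_homs (Quot_pow p I n) (E p (enat n) I)"
    unfolding Quot_pow_def E_eq
    by (rule quot_rng_homsI[OF ideal_in_J ideal_in_D, where g = "\<lambda>a. trunc n (orbit a)"])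
       (simp_all add: alpha_n_coset[OF n] trunc_orbit_in_D orbit_simps trunc_simps)
  moreover have "bij_betw (alpha_n p \<phi> I n) (carr (Quot_pow p I n)) (carr (E p (enat n) I))"
    unfolding bij_betw_def carr_Quot_pow carr_E
  proof
    show "inj_on (alpha_n p \<phi> I n) (range (\<lambda>a. a +o J n))"
    proof (rule inj_onI, elim rangeE)
      fix C C' a b
      assume "alpha_n p \<phi> I n C = alpha_n p \<phi> I n C'" and C: "C = a +o J n" "C' = b +o J n"
      then have "trunc n (orbit (a - b)) \<in> DI (enat n)"
        by (simp add: alpha_n_coset[OF n] coset_DI_iff trunc_simps orbit_simps)
      then show "C = C'" by (simp add: C coset_J_iff trunc_orbit_in_DI_iff[OF n])
    qed
    show "alpha_n p \<phi> I n ` range (\<lambda>a. a +o J n) = (\<lambda>s. s +o DI (enat n)) ` D (enat n)"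
    proof (intro equalityI subsetI)
      fix e assume "e \<in> (\<lambda>s. s +o DI (enat n)) ` D (enat n)"
      then obtain s where "s \<in> D (enat n)" "e = s +o DI (enat n)" by blast
      then have "e = alpha_n p \<phi> I n (unorbit s n +o J n)" using alpha_n_unorbit[OF n] by simp
      then show "e \<in> alpha_n p \<phi> I n ` range (\<lambda>a. a +o J n)" by blast
    qed (auto simp: alpha_n_coset[OF n] trunc_orbit_in_D)
  qed
  ultimately show ?thesis by (simp add: rng_isos_def)
qed

text \<open>
  \<open>E\<^sub>n\<close> of the Frobenius acts on representatives by applying \<open>\<phi>\<close> to each component: \<open>\<phi>\<close> sends
  \<open>V\<^sup>\<mu>\<langle>a\<rangle>\<close> to \<open>V\<^sup>\<mu>\<langle>\<phi>(a)\<rangle>\<close>, and \<open>\<phi>(a)\<close> lifts the \<open>p\<close>-th power of the class of \<open>a\<close>.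
\<close>

lemma phi_comp_in_D: "s \<in> D N \<Longrightarrow> \<phi> \<circ> s \<in> D N"
proof (rule dworkI)
  assume s: "s \<in> D N"
  fix \<nu> assume "enat (Suc \<nu>) < N"
  then obtain b where "s (Suc \<nu>) - \<phi> (s \<nu>) = nsmul (p ^ Suc \<nu>) b" using dworkD(2)[OF s] by blast
  then have "(\<phi> \<circ> s) (Suc \<nu>) - \<phi> ((\<phi> \<circ> s) \<nu>) = nsmul (p ^ Suc \<nu>) (\<phi> b)"
    by (simp flip: rng_hom_diff[OF hom] rng_hom_nsmul[OF hom] del: power_Suc)
  then show "(\<phi> \<circ> s) (Suc \<nu>) - \<phi> ((\<phi> \<circ> s) \<nu>) \<in> P (Suc \<nu>)" by blast
qed (auto simp: dworkD rng_hom_zero[OF hom])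

lemma phi_comp_simps:
  "\<phi> \<circ> (s + t) = (\<phi> \<circ> s) + (\<phi> \<circ> t)" "\<phi> \<circ> (s * t) = (\<phi> \<circ> s) * (\<phi> \<circ> t)" for s t :: "nat \<Rightarrow> 'a"
  by (auto simp: rng_homD[OF hom])

text \<open>
  The class of \<open>V\<^sup>\<mu>\<langle>a\<rangle>\<close> depends only on \<open>a\<close> modulo \<open>I\<close>, because a congruence modulo \<open>I\<close> improves to
  one modulo \<open>I\<^sup>k\<^sup>+\<^sup>1\<close> for the \<open>p\<^sup>k\<close>-th powers.
\<close>

lemma Vgen_cong:
  assumes "a - b \<in> I"
  shows "Vgen p N \<mu> a - Vgen p N \<mu> b \<in> DI N"
  unfolding DI_iff
proof (intro conjI allI impI)
  show "Vgen p N \<mu> a - Vgen p N \<mu> b \<in> D N"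
    using Vgen_in_dwork[OF detects_UNIV] by (intro D_diff) auto
next
  fix \<nu> assume \<nu>: "enat \<nu> < N"
  show "(Vgen p N \<mu> a - Vgen p N \<mu> b) \<nu> \<in> J (Suc \<nu>)"
  proof (cases "\<mu> \<le> \<nu>")
    case True
    have "nsmul (p ^ \<mu>) (rpow a (p ^ (\<nu> - \<mu>)) - rpow b (p ^ (\<nu> - \<mu>))) \<in> J (Suc (\<nu> - \<mu>) + \<mu>)"
      using rpow_cong_J[OF assms] by (rule J_nsmul_power)
    then show ?thesis using True \<nu> by (simp add: Vgen_def nsmul_diff)
  qed (use J_zero in \<open>simp add: Vgen_def\<close>)
qed

lemma E_map_coset:
  fixes \<pi> :: "'a \<Rightarrow> 'r::comm_ring"
  assumes \<pi>: "rng_hom \<pi>" "surj \<pi>" "I = ker \<pi>" and s: "s \<in> D (enat n)"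
  shows "E_map p n \<pi> \<pi> (\<lambda>r. rpow r p) (s +o DI (enat n)) = (\<phi> \<circ> s) +o DI (enat n)"
proof -
  have I: "a - b \<in> I \<longleftrightarrow> \<pi> a = \<pi> b" for a b
    by (simp add: \<pi>(3) ker_def rng_hom_diff[OF \<pi>(1)])
  have lift_\<pi>: "\<pi> (\<phi> a) = rpow (\<pi> a) p" for a
  proof -
    obtain b where "\<phi> a - rpow a p = nsmul p b" using lift by (auto simp: lifts_Frobenius_def)
    then have "\<phi> a - rpow a p \<in> I" using p_mem by simp
    then show ?thesis using p_ge_1 by (simp add: I rng_hom_rpow[OF \<pi>(1)])
  qed
  let ?E = "carr (E p (enat n) I)"
  define F where "F = restrict (induced (\<lambda>s. (\<phi> \<circ> s) +o DI (enat n))) ?E"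
  have F: "F (t +o DI (enat n)) = (\<phi> \<circ> t) +o DI (enat n)" if t: "t \<in> D (enat n)" for t
  proof -
    have "induced (\<lambda>s. (\<phi> \<circ> s) +o DI (enat n)) (t +o DI (enat n)) = (\<phi> \<circ> t) +o DI (enat n)"
    proof (rule induced_coset[OF add_subgroup_DI])
      fix j assume "j \<in> DI (enat n)"
      then have "\<phi> \<circ> j \<in> DI (enat n)"
        unfolding DI_iff using phi_comp_in_D by (simp add: phi_J_iff)
      then show "(\<phi> \<circ> (t + j)) +o DI (enat n) = (\<phi> \<circ> t) +o DI (enat n)"
        by (simp add: coset_DI_iff phi_comp_simps)
    qed
    then show ?thesis using t by (simp add: F_def carr_E)
  qed
  have is_map: "is_E_map p n \<pi> \<pi> (\<lambda>r. rpow r p) F"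
    unfolding is_E_map_def \<pi>(3)[symmetric]
  proof (intro conjI allI impI)
    show "F \<in> rng_homs (E p (enat n) I) (E p (enat n) I)"
      unfolding E_eq
      by (rule quot_rng_homsI[OF ideal_in_D ideal_in_D, where g = "\<lambda>s. \<phi> \<circ> s"])
         (simp_all add: F phi_comp_in_D phi_comp_simps D_add D_mult)
    show "F \<in> extensional ?E" by (simp add: F_def)
  next
    fix \<mu> a a' assume \<mu>: "\<mu> < n" and a': "\<pi> a' = rpow (\<pi> a) p"
    have "\<phi> \<circ> Vgen p (enat n) \<mu> a = Vgen p (enat n) \<mu> (\<phi> a)"
      using p_power_ge_1
      by (auto simp: Vgen_def rng_hom_zero[OF hom] rng_hom_nsmul[OF hom] rng_hom_rpow[OF hom])
    moreover have "\<phi> a - a' \<in> I" by (simp add: I lift_\<pi> a')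
    then have "Vgen p (enat n) \<mu> (\<phi> a) - Vgen p (enat n) \<mu> a' \<in> DI (enat n)" by (rule Vgen_cong)
    ultimately show "F (Vgen p (enat n) \<mu> a +o X p (enat n) I) = Vgen p (enat n) \<mu> a' +o X p (enat n) I"
      using Vgen_in_dwork[OF detects_UNIV]
      by (simp add: X_I_eq F coset_DI_iff)
  qed
  have unique: "G = F" if G: "is_E_map p n \<pi> \<pi> (\<lambda>r. rpow r p) G" for G
  proof (rule extensionalityI[of G ?E F])
    show "G \<in> extensional ?E" "F \<in> extensional ?E"
      using G is_map by (simp_all add: is_E_map_def \<pi>(3))
    \<comment> \<open>\<open>F\<close> and \<open>G\<close> agree on a subgroup, which contains the classes that generate \<open>E\<^sub>n(R)\<close>.\<close>
    let ?H = "{t \<in> D (enat n). G (t +o DI (enat n)) = F (t +o DI (enat n))}"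
    have additive: "M ((t + u) +o DI (enat n)) = M (t +o DI (enat n)) + M (u +o DI (enat n))"
      if "is_E_map p n \<pi> \<pi> (\<lambda>r. rpow r p) M" "t \<in> D (enat n)" "u \<in> D (enat n)" for M t u
      using that
      by (simp add: is_E_map_def rng_homs_def \<pi>(3)[symmetric] carr_E E_eq radd_quot carr_quot
          flip: coset_plus[OF add_subgroup_DI])
    have carrier: "\<exists>v\<in>D (enat n). M (t +o DI (enat n)) = v +o DI (enat n)"
      if "is_E_map p n \<pi> \<pi> (\<lambda>r. rpow r p) M" "t \<in> D (enat n)" for M t
    proof -
      have "M (t +o DI (enat n)) \<in> carr (E p (enat n) I)"
        using that by (auto simp: is_E_map_def rng_homs_def \<pi>(3)[symmetric] carr_E)
      then show ?thesis by (auto simp: carr_E)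
    qed
    have cancel: "C = C'"
      if "C = v +o DI (enat n)" "C' = v' +o DI (enat n)" "C + (w +o DI (enat n)) = C' + (w +o DI (enat n))"
      for C C' v v' w
      using that by (simp add: coset_plus[OF add_subgroup_DI] coset_DI_iff)
    have "t \<in> ?H" if t: "t \<in> D (enat n)" for t
    proof (rule dwork_finite_generated[OF detects_UNIV _ _ t])
      have diff: "t - u \<in> ?H" if t: "t \<in> ?H" and u: "u \<in> ?H" for t u
      proof -
        have tu: "t - u \<in> D (enat n)" using t u D_diff by simp
        obtain v v' w where vw: "G ((t - u) +o DI (enat n)) = v +o DI (enat n)"
          "F ((t - u) +o DI (enat n)) = v' +o DI (enat n)" "F (u +o DI (enat n)) = w +o DI (enat n)"
          using carrier[OF G tu] carrier[OF is_map tu] carrier[OF is_map, of u] u by blast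
        have "G ((t - u) +o DI (enat n)) + (w +o DI (enat n)) = F ((t - u) +o DI (enat n)) + (w +o DI (enat n))"
          using additive[OF G tu, of u] additive[OF is_map tu, of u] t u vw(3) by simp
        then show ?thesis using cancel[OF vw(1,2)] tu by simp
      qed
      have "0 \<in> ?H"
      proof -
        have z: "0 \<in> D (enat n)" using add_subgroupD(1)[OF add_subgroup_D] .
        obtain v v' where v: "G (0 +o DI (enat n)) = v +o DI (enat n)" "F (0 +o DI (enat n)) = v' +o DI (enat n)"
          using carrier[OF G z] carrier[OF is_map z] by blast
        have "- v' \<in> DI (enat n)" "- v \<in> DI (enat n)"
          using additive[OF G z z] additive[OF is_map z z] v
          by (simp_all add: coset_plus[OF add_subgroup_DI] coset_DI_iff)
        then have "- v' - - v \<in> DI (enat n)" by (rule DI_diff)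
        then show ?thesis using z v by (simp add: coset_DI_iff)
      qed
      then show "add_subgroup ?H" using diff unfolding add_subgroup_def by blast
    next
      fix \<mu> a assume \<mu>: "\<mu> < n"
      obtain a' where "\<pi> a' = rpow (\<pi> a) p" using \<pi>(2) by (metis surjD)
      then show "Vgen p (enat n) \<mu> a \<in> ?H"
        using G is_map \<mu> Vgen_in_dwork[OF detects_UNIV]
        by (simp add: is_E_map_def \<pi>(3)[symmetric] X_I_eq)
    qed
    then show "G C = F C" if "C \<in> ?E" for C using that by (auto simp: carr_E)
  qed
  have "E_map p n \<pi> \<pi> (\<lambda>r. rpow r p) = F"
    unfolding E_map_def using is_map unique by (rule the_equality)
  then show ?thesis using F[OF s] by simp
qed

lemma E_map_alpha_n:
  fixes \<pi> :: "'a \<Rightarrow> 'r::comm_ring"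
  assumes "rng_hom \<pi>" "surj \<pi>" "I = ker \<pi>" and n: "n \<ge> 1"
  shows "E_map p n \<pi> \<pi> (\<lambda>r. rpow r p) (alpha_n p \<phi> I n (a +o J n))
    = alpha_n p \<phi> I n (phi_quot p \<phi> I n (a +o J n))"
proof -
  have "\<phi> \<circ> trunc n (orbit a) = trunc n (orbit (\<phi> a))"
    by (auto simp: trunc_def orbit_def rng_hom_zero[OF hom] funpow_swap1)
  then show ?thesis
    by (simp add: alpha_n_coset[OF n] phi_quot_coset E_map_coset[OF assms(1-3) trunc_orbit_in_D])
qed

section \<open>The comparison map in the limit\<close>

text \<open>
  Elements of the projective limit are given by sequences of representatives; the value at the
  index \<open>0\<close> is arbitrary.
\<close>

definition coherent :: "(nat \<Rightarrow> 'a) \<Rightarrow> bool" where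
  "coherent a \<longleftrightarrow> (\<forall>m n. 1 \<le> n \<and> n \<le> m \<longrightarrow> a m - a n \<in> J n)"

definition lim_class :: "(nat \<Rightarrow> 'a) \<Rightarrow> nat \<Rightarrow> 'a set" where
  "lim_class a = (\<lambda>n\<in>{1..}. a n +o J n)"

lemma lim_class_eq_iff: "lim_class a = lim_class b \<longleftrightarrow> (\<forall>n\<ge>1. a n - b n \<in> J n)"
proof
  assume eq: "lim_class a = lim_class b"
  show "\<forall>n\<ge>1. a n - b n \<in> J n"
  proof (intro allI impI)
    fix n :: nat assume "n \<ge> 1"
    then show "a n - b n \<in> J n"
      using fun_cong[OF eq, of n] by (simp add: lim_class_def coset_J_iff)
  qed
next
  assume "\<forall>n\<ge>1. a n - b n \<in> J n"
  then show "lim_class a = lim_class b"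
    unfolding lim_class_def by (intro restrict_ext) (simp add: coset_J_iff)
qed

lemma reduce_coset: "n \<le> m \<Longrightarrow> induced (\<lambda>a. a +o J n) (a +o J m) = a +o J n"
  by (rule induced_coset[OF add_subgroup_J]) (use J_antimono in \<open>auto simp: coset_J_iff\<close>)

lemma carr_Proj_lim: "carr (Proj_lim p I) = lim_class ` {a. coherent a}"
proof (intro equalityI subsetI)
  fix x assume "x \<in> carr (Proj_lim p I)"
  then have x: "x \<in> extensional {1..}" "\<And>n. n \<ge> 1 \<Longrightarrow> x n \<in> range (\<lambda>a. a +o J n)"
    "\<And>m n. 1 \<le> n \<Longrightarrow> n \<le> m \<Longrightarrow> induced (\<lambda>a. a +o J n) (x m) = x n"
    by (auto simp: Proj_lim_def carr_Quot_pow PiE_iff)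
  from x(2) have "\<forall>n. \<exists>b. n \<ge> 1 \<longrightarrow> x n = b +o J n" by blast
  then obtain a where a: "\<And>n. n \<ge> 1 \<Longrightarrow> x n = a n +o J n" by metis
  have "coherent a"
    unfolding coherent_def
  proof (intro allI impI, elim conjE)
    fix m n :: nat assume mn: "1 \<le> n" "n \<le> m"
    then have "a m +o J n = a n +o J n" using x(3)[OF mn] a[of m] a[of n] by (simp add: reduce_coset)
    then show "a m - a n \<in> J n" by (simp add: coset_J_iff)
  qed
  moreover have "x = lim_class a"
    by (rule extensionalityI[OF x(1), of "lim_class a"]) (auto simp: lim_class_def a)
  ultimately show "x \<in> lim_class ` {a. coherent a}" by blast
next
  fix x assume "x \<in> lim_class ` {a. coherent a}"
  then obtain a where "coherent a" "x = lim_class a" by blast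
  then show "x \<in> carr (Proj_lim p I)"
    by (auto simp: Proj_lim_def carr_Quot_pow lim_class_def coherent_def reduce_coset coset_J_iff)
qed

text \<open>
  The class of \<open>s\<close> in \<open>E(R)\<close> maps to \<open>\<alpha>\<^sub>n(a\<^sub>n + I\<^sup>n)\<close> for all \<open>n \<ge> 1\<close>. So \<open>alpha_hat\<close> is studied through
  this relation between representatives, which is compatible with sums and products.
\<close>

definition lifts :: "(nat \<Rightarrow> 'a) \<Rightarrow> (nat \<Rightarrow> 'a) \<Rightarrow> bool" where
  "lifts s a \<longleftrightarrow> s \<in> D \<infinity> \<and> (\<forall>n\<ge>1. trunc n s - trunc n (orbit (a n)) \<in> DI (enat n))"

text \<open>
  The orbits of the representatives agree up to \<open>X\<^sub>n(I)\<close> only. Since the elements of \<open>X\<^sub>n(I)\<close> extend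
  to \<open>X(I)\<close>, they can be corrected one after the other so that longer and longer initial segments
  agree exactly, and then they converge.
\<close>

lemma lifts_exists:
  assumes "coherent a"
  shows "\<exists>s. lifts s a"
proof -
  let ?P = "\<lambda>n S. S \<in> D \<infinity> \<and> trunc (Suc n) (S - orbit (a (Suc n))) \<in> DI (enat (Suc n))"
  let ?Q = "\<lambda>n S S'. \<forall>\<nu>\<le>n. S' \<nu> = S (\<nu>::nat)"
  have "\<exists>S. \<forall>n. ?P n (S n) \<and> ?Q n (S n) (S (Suc n))"
  proof (rule dependent_nat_choice)
    have "trunc (Suc 0) (orbit (a (Suc 0)) - orbit (a (Suc 0))) = 0"
      by (auto simp: trunc_def)
    then show "\<exists>S. ?P 0 S" using DI_zero orbit_in_D by metis
  next
    fix S n assume S: "?P n S"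
    let ?o = "orbit (a (Suc (Suc n)))"
    have "a (Suc (Suc n)) - a (Suc n) \<in> J (Suc n)"
      using assms by (simp add: coherent_def)
    then have "trunc (Suc n) (?o - orbit (a (Suc n))) \<in> DI (enat (Suc n))"
      by (simp add: trunc_orbit_in_DI_iff flip: orbit_simps)
    then have "trunc (Suc n) (?o - orbit (a (Suc n))) - trunc (Suc n) (S - orbit (a (Suc n)))
        \<in> DI (enat (Suc n))"
      using S DI_diff by blast
    then have "trunc (Suc n) (?o - S) \<in> DI (enat (Suc n))"
      by (simp flip: trunc_simps)
    then obtain u where u: "u \<in> DI \<infinity>" "trunc (Suc n) u = trunc (Suc n) (?o - S)"
      using trunc_surj_DI by blast
    have "?o - u \<in> D \<infinity>" using orbit_in_D u(1) DI_subset_D D_diff by blast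
    moreover have "trunc (Suc (Suc n)) ((?o - u) - ?o) \<in> DI (enat (Suc (Suc n)))"
      using add_subgroupD(3)[OF add_subgroup_DI u(1)] by (intro trunc_in_dwork) simp
    moreover have "(?o - u) \<nu> = S \<nu>" if "\<nu> \<le> n" for \<nu>
      using fun_cong[OF u(2), of \<nu>] that by (simp add: trunc_def)
    ultimately show "\<exists>S'. ?P (Suc n) S' \<and> ?Q n S S'" by blast
  qed
  then obtain S where S: "\<And>n. S n \<in> D \<infinity>"
    "\<And>n. trunc (Suc n) (S n - orbit (a (Suc n))) \<in> DI (enat (Suc n))"
    "\<And>n \<nu>. \<nu> \<le> n \<Longrightarrow> S (Suc n) \<nu> = S n \<nu>"
    by blast
  define s where "s = (\<lambda>\<nu>. S \<nu> \<nu>)"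
  have s: "S n \<nu> = s \<nu>" if "\<nu> \<le> n" for n \<nu>
    using that by (induction n rule: dec_induct) (simp_all add: s_def S(3))
  have "s \<in> D \<infinity>"
  proof (rule dworkI)
    fix \<nu>
    have "S (Suc \<nu>) (Suc \<nu>) - \<phi> (S (Suc \<nu>) \<nu>) \<in> P (Suc \<nu>)"
      using dworkD(2)[OF S(1)] by simp
    then show "s (Suc \<nu>) - \<phi> (s \<nu>) \<in> P (Suc \<nu>)" by (simp only: s le_SucI order_refl)
  qed simp_all
  moreover have "trunc n s - trunc n (orbit (a n)) \<in> DI (enat n)" if n1: "n \<ge> 1" for n
  proof -
    obtain m where n: "n = Suc m" using n1 by (cases n) auto
    have "trunc n s = trunc n (S m)" using s by (auto simp: trunc_def n)
    then show ?thesis using S(2)[of m] by (simp add: n trunc_simps)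
  qed
  ultimately show ?thesis by (auto simp: lifts_def)
qed

lemma DI_infinity_if_trunc:
  assumes "s \<in> D \<infinity>" "\<And>n. n \<ge> 1 \<Longrightarrow> trunc n s \<in> DI (enat n)"
  shows "s \<in> DI \<infinity>"
proof -
  have "s \<nu> \<in> J (Suc \<nu>)" for \<nu>
  proof -
    have "trunc (Suc \<nu>) s \<nu> \<in> J (Suc \<nu>)" using assms(2)[of "Suc \<nu>"] unfolding DI_iff by simp
    then show ?thesis by (simp add: trunc_def)
  qed
  then show ?thesis using assms(1) by (simp add: DI_iff)
qed

text \<open>
  The class of \<open>s\<close> is the only one with the prescribed images, since a Dwork sequence all of whose
  truncations lie in the \<open>X\<^sub>n(I)\<close> lies in \<open>X(I)\<close>.
\<close>

lemma alpha_hat_lim_class: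
  assumes "lifts s a"
  shows "alpha_hat p \<phi> I (lim_class a) = s +o DI \<infinity>"
  unfolding alpha_hat_def
proof (rule the_equality)
  have s: "s \<in> D \<infinity>" "\<And>n. n \<ge> 1 \<Longrightarrow> trunc n s - trunc n (orbit (a n)) \<in> DI (enat n)"
    using assms by (auto simp: lifts_def)
  have alpha: "alpha_n p \<phi> I n (lim_class a n) = trunc n (orbit (a n)) +o DI (enat n)" if "n \<ge> 1" for n
    using that by (simp add: lim_class_def alpha_n_coset)
  show "s +o DI \<infinity> \<in> carr (E p \<infinity> I) \<and>
      (\<forall>n\<ge>1. E_proj p I n (s +o DI \<infinity>) = alpha_n p \<phi> I n (lim_class a n))"
    using s by (auto simp: carr_E E_proj_coset alpha coset_DI_iff)
  fix e assume e: "e \<in> carr (E p \<infinity> I) \<and> (\<forall>n\<ge>1. E_proj p I n e = alpha_n p \<phi> I n (lim_class a n))"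
  then obtain t where t: "t \<in> D \<infinity>" "e = t +o DI \<infinity>" by (auto simp: carr_E)
  have "trunc n (t - s) \<in> DI (enat n)" if n: "n \<ge> 1" for n
  proof -
    have "trunc n t - trunc n (orbit (a n)) \<in> DI (enat n)"
    proof -
      have "E_proj p I n e = alpha_n p \<phi> I n (lim_class a n)" using e n by blast
      then show ?thesis by (simp add: t(2) alpha[OF n] E_proj_coset coset_DI_iff)
    qed
    then have "(trunc n t - trunc n (orbit (a n))) - (trunc n s - trunc n (orbit (a n))) \<in> DI (enat n)"
      using s(2)[OF n] by (rule DI_diff)
    then show ?thesis by (simp add: trunc_simps)
  qed
  then have "t - s \<in> DI \<infinity>" using D_diff[OF t(1) s(1)] DI_infinity_if_trunc by blast
  then show "e = s +o DI \<infinity>" by (simp add: t(2) coset_DI_iff)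
qed

lemma lifts_unorbit:
  assumes s: "s \<in> D \<infinity>"
  shows "lifts s (unorbit s)"
  unfolding lifts_def
proof (intro conjI s allI impI)
  fix n :: nat assume n: "n \<ge> 1"
  then have "unorbit (trunc n s) n = unorbit s n" by (simp add: unorbit_def trunc_def)
  then show "trunc n s - trunc n (orbit (unorbit s n)) \<in> DI (enat n)"
    using coset_unorbit[OF n trunc_in_dwork[OF s]] by simp
qed

lemma lifts_last_component:
  assumes "lifts s a" "1 \<le> n" "n \<le> m"
  shows "s (n - 1) - (\<phi> ^^ (n - 1)) (a m) \<in> J n"
proof -
  have "trunc m s - trunc m (orbit (a m)) \<in> DI (enat m)"
    using assms by (simp add: lifts_def)
  moreover have lt: "n - 1 < m" using assms by linarith
  then have "enat (n - 1) < enat m" by simp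
  ultimately have "(trunc m s - trunc m (orbit (a m))) (n - 1) \<in> J (Suc (n - 1))"
    unfolding DI_iff by blast
  then show ?thesis using assms(2) lt by (simp add: trunc_def orbit_def)
qed

lemma lifts_unique:
  assumes "lifts s a" "lifts t b" "s - t \<in> DI \<infinity>"
  shows "lim_class a = lim_class b"
  unfolding lim_class_eq_iff
proof (intro allI impI)
  fix n :: nat assume n: "n \<ge> 1"
  have "(s - t) (n - 1) \<in> J (Suc (n - 1))" using assms(3) unfolding DI_iff by simp
  then have "s (n - 1) - t (n - 1) \<in> J n" using n by simp
  then have "(s (n - 1) - t (n - 1)) - (s (n - 1) - (\<phi> ^^ (n - 1)) (a n))
      + (t (n - 1) - (\<phi> ^^ (n - 1)) (b n)) \<in> J n"
    by (rule J_add[OF J_diff[OF _ lifts_last_component[OF assms(1) n order_refl]]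
          lifts_last_component[OF assms(2) n order_refl]])
  then have "(\<phi> ^^ (n - 1)) (a n - b n) \<in> J n"
    by (simp add: rng_hom_diff[OF hom_funpow])
  then show "a n - b n \<in> J n" by (simp only: phi_funpow_J_iff)
qed

lemma coherent_unorbit:
  assumes "s \<in> D \<infinity>"
  shows "coherent (unorbit s)"
  unfolding coherent_def
proof (intro allI impI, elim conjE)
  fix m n :: nat assume mn: "1 \<le> n" "n \<le> m"
  have "(\<phi> ^^ (n - 1)) (unorbit s n) - (\<phi> ^^ (n - 1)) (unorbit s m) \<in> J n"
    using lifts_last_component[OF lifts_unorbit[OF assms] mn] by (simp only: phi_funpow_unorbit)
  then have "unorbit s n - unorbit s m \<in> J n"
    by (simp only: phi_funpow_J_iff flip: rng_hom_diff[OF hom_funpow])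
  then show "unorbit s m - unorbit s n \<in> J n" using J_minus by fastforce
qed

lemma lifts_add: "lifts s a \<Longrightarrow> lifts t b \<Longrightarrow> lifts (s + t) (a + b)"
  unfolding lifts_def
proof (elim conjE, intro conjI allI impI)
  fix n :: nat
  assume n: "n \<ge> 1" and "\<forall>n\<ge>1. trunc n s - trunc n (orbit (a n)) \<in> DI (enat n)"
    and "\<forall>n\<ge>1. trunc n t - trunc n (orbit (b n)) \<in> DI (enat n)"
  then have "(trunc n s - trunc n (orbit (a n))) + (trunc n t - trunc n (orbit (b n))) \<in> DI (enat n)"
    by (intro DI_add) auto
  then show "trunc n (s + t) - trunc n (orbit ((a + b) n)) \<in> DI (enat n)"
    by (simp add: trunc_simps orbit_simps algebra_simps)
qed (rule D_add)

lemma lifts_mult: "lifts s a \<Longrightarrow> lifts t b \<Longrightarrow> lifts (s * t) (a * b)"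
  unfolding lifts_def
proof (elim conjE, intro conjI allI impI)
  fix n :: nat
  assume n: "n \<ge> 1" and "s \<in> D \<infinity>"
    and "\<forall>n\<ge>1. trunc n s - trunc n (orbit (a n)) \<in> DI (enat n)"
    and "\<forall>n\<ge>1. trunc n t - trunc n (orbit (b n)) \<in> DI (enat n)"
  then have "trunc n s * (trunc n t - trunc n (orbit (b n)))
      + (trunc n s - trunc n (orbit (a n))) * trunc n (orbit (b n)) \<in> DI (enat n)"
    using trunc_orbit_in_D trunc_in_dwork
    by (intro DI_add ideal_inD(3,4)[OF ideal_in_D]) auto
  then show "trunc n (s * t) - trunc n (orbit ((a * b) n)) \<in> DI (enat n)"
    by (simp add: trunc_simps orbit_simps algebra_simps)
qed (rule D_mult)

lemma radd_Proj_lim: "radd (Proj_lim p I) (lim_class a) (lim_class b) = lim_class (a + b)"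
  by (rule ext)
     (simp add: Proj_lim_def lim_class_def Quot_pow_def radd_quot coset_plus[OF add_subgroup_J] restrict_def)

lemma rmul_Proj_lim: "rmul (Proj_lim p I) (lim_class a) (lim_class b) = lim_class (a * b)"
  by (rule ext)
     (simp add: Proj_lim_def lim_class_def Quot_pow_def rmul_quot coset_times[OF ideal_in_J] restrict_def)

lemma alpha_hat_bij: "bij_betw (alpha_hat p \<phi> I) (carr (Proj_lim p I)) (carr (E p \<infinity> I))"
  unfolding bij_betw_def
proof
  show "inj_on (alpha_hat p \<phi> I) (carr (Proj_lim p I))"
    unfolding carr_Proj_lim
  proof (rule inj_onI, elim imageE CollectE)
    fix x y a b assume eq: "alpha_hat p \<phi> I x = alpha_hat p \<phi> I y"
      and ab: "coherent a" "coherent b" "x = lim_class a" "y = lim_class b"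
    obtain s t where st: "lifts s a" "lifts t b" using lifts_exists ab by blast
    then have "s - t \<in> DI \<infinity>" using eq by (simp add: ab alpha_hat_lim_class coset_DI_iff)
    then show "x = y" using lifts_unique st ab by simp
  qed
  show "alpha_hat p \<phi> I ` carr (Proj_lim p I) = carr (E p \<infinity> I)"
    unfolding carr_Proj_lim carr_E
  proof (intro equalityI subsetI)
    fix e assume "e \<in> (\<lambda>s. s +o DI \<infinity>) ` D \<infinity>"
    then obtain s where s: "s \<in> D \<infinity>" "e = s +o DI \<infinity>" by blast
    then have "e = alpha_hat p \<phi> I (lim_class (unorbit s))"
      using alpha_hat_lim_class[OF lifts_unorbit] by simp
    then show "e \<in> alpha_hat p \<phi> I ` lim_class ` {a. coherent a}"
      using coherent_unorbit[OF s(1)] by blast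
  next
    fix e assume "e \<in> alpha_hat p \<phi> I ` lim_class ` {a. coherent a}"
    then obtain a where a: "coherent a" "e = alpha_hat p \<phi> I (lim_class a)" by blast
    obtain s where s: "lifts s a" using lifts_exists[OF a(1)] by blast
    then have "e = s +o DI \<infinity>" "s \<in> D \<infinity>" using a(2) alpha_hat_lim_class by (auto simp: lifts_def)
    then show "e \<in> (\<lambda>s. s +o DI \<infinity>) ` D \<infinity>" by blast
  qed
qed

theorem alpha_hat_iso: "alpha_hat p \<phi> I \<in> rng_isos (Proj_lim p I) (E p \<infinity> I)"
proof -
  have "alpha_hat p \<phi> I \<in> rng_homs (Proj_lim p I) (E p \<infinity> I)"
    unfolding rng_homs_def
  proof (intro CollectI conjI ballI)
    show "alpha_hat p \<phi> I \<in> carr (Proj_lim p I) \<rightarrow> carr (E p \<infinity> I)"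
      using alpha_hat_bij by (auto simp: bij_betw_def)
  next
    fix x y assume "x \<in> carr (Proj_lim p I)" "y \<in> carr (Proj_lim p I)"
    then obtain a b where ab: "coherent a" "coherent b" "x = lim_class a" "y = lim_class b"
      by (auto simp: carr_Proj_lim)
    obtain s t where st: "lifts s a" "lifts t b" using lifts_exists ab by blast
    then have D: "s \<in> D \<infinity>" "t \<in> D \<infinity>" by (simp_all add: lifts_def)
    show "alpha_hat p \<phi> I (radd (Proj_lim p I) x y)
        = radd (E p \<infinity> I) (alpha_hat p \<phi> I x) (alpha_hat p \<phi> I y)"
      by (simp add: ab radd_Proj_lim alpha_hat_lim_class[OF lifts_add[OF st]]
          alpha_hat_lim_class[OF st(1)] alpha_hat_lim_class[OF st(2)] E_eq radd_quot
          coset_plus[OF add_subgroup_DI])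
    show "alpha_hat p \<phi> I (rmul (Proj_lim p I) x y)
        = rmul (E p \<infinity> I) (alpha_hat p \<phi> I x) (alpha_hat p \<phi> I y)"
      by (simp add: ab rmul_Proj_lim alpha_hat_lim_class[OF lifts_mult[OF st]]
          alpha_hat_lim_class[OF st(1)] alpha_hat_lim_class[OF st(2)] E_eq rmul_quot
          coset_times[OF ideal_in_D] D)
  qed
  then show ?thesis using alpha_hat_bij by (simp add: rng_isos_def)
qed

lemma carr_Proj_lim_subset: "carr (Proj_lim p I) \<subseteq> (\<Pi>\<^sub>E n\<in>{1..}. carr (Quot_pow p I n))"
  by (auto simp: Proj_lim_def)

lemma topspace_Proj_lim_top: "topspace (Proj_lim_top p I) = carr (Proj_lim p I)"
  using carr_Proj_lim_subset by (simp add: Proj_lim_top_def Int_absorb1)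

lemma openin_E_top:
  "openin (E_top p \<infinity> I) U \<longleftrightarrow> U \<subseteq> carr (E p \<infinity> I) \<and>
     (\<forall>s\<in>D \<infinity>. s +o DI \<infinity> \<in> U \<longrightarrow>
       (\<exists>n. \<forall>t\<in>D \<infinity>. (\<forall>\<nu><n. t \<nu> = s \<nu>) \<longrightarrow> t +o DI \<infinity> \<in> U))"
proof -
  have top: "topspace (subtopology (seq_top \<infinity>) (D \<infinity>)) = D \<infinity>"
    using dwork_subset_seqs[of _ \<infinity>] by (auto simp: topspace_seq_top)
  show ?thesis
    unfolding E_top_def X_UNIV_eq X_I_eq openin_quotient_top top
      openin_subtopology_seq_top[OF dwork_subset_seqs] carr_E by auto
qed

lemma topspace_E_top: "topspace (E_top p \<infinity> I) = carr (E p \<infinity> I)"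
proof -
  have "openin (E_top p \<infinity> I) (carr (E p \<infinity> I))"
    by (auto simp: openin_E_top carr_E)
  then show ?thesis by (metis openin_E_top openin_subset openin_topspace subset_antisym)
qed

text \<open>
  If two elements of the limit have the same component at \<open>n\<close>, then their images have
  representatives that agree before the index \<open>n\<close>, again because \<open>X(I) \<rightarrow> X\<^sub>n(I)\<close> is onto.
\<close>

lemma alpha_hat_continuous: "continuous_map (Proj_lim_top p I) (E_top p \<infinity> I) (alpha_hat p \<phi> I)"
  unfolding continuous_map_def topspace_Proj_lim_top topspace_E_top
proof (intro conjI allI impI)
  show "alpha_hat p \<phi> I \<in> carr (Proj_lim p I) \<rightarrow> carr (E p \<infinity> I)"
    using alpha_hat_bij by (auto simp: bij_betw_def)
  fix U assume U: "openin (E_top p \<infinity> I) U"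
  let ?V = "{x \<in> carr (Proj_lim p I). alpha_hat p \<phi> I x \<in> U}"
  show "openin (Proj_lim_top p I) ?V"
  proof (subst openin_subopen, intro ballI)
    fix x assume "x \<in> ?V"
    then obtain a where a: "coherent a" "x = lim_class a" "alpha_hat p \<phi> I x \<in> U"
      by (auto simp: carr_Proj_lim)
    obtain s where s: "lifts s a" using lifts_exists[OF a(1)] by blast
    then have sD: "s \<in> D \<infinity>" by (simp add: lifts_def)
    have "s +o DI \<infinity> \<in> U" using a alpha_hat_lim_class[OF s] by simp
    then obtain k where k: "\<And>t. t \<in> D \<infinity> \<Longrightarrow> \<forall>\<nu><k. t \<nu> = s \<nu> \<Longrightarrow> t +o DI \<infinity> \<in> U"
      using U sD unfolding openin_E_top by blast
    define n where "n = Suc k"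
    let ?T = "{y \<in> topspace (Proj_lim_top p I). y n \<in> {x n}}"
    have x: "x \<in> carr (Proj_lim p I)" using a by (auto simp: carr_Proj_lim)
    have "continuous_map (Proj_lim_top p I) (discrete_topology (carr (Quot_pow p I n))) (\<lambda>y. y n)"
      unfolding Proj_lim_top_def
      by (rule continuous_map_from_subtopology, rule continuous_map_product_projection) (simp add: n_def)
    moreover have "openin (discrete_topology (carr (Quot_pow p I n))) {x n}"
      using x carr_Proj_lim_subset by (auto simp: n_def PiE_iff)
    ultimately have "openin (Proj_lim_top p I) ?T" by (rule openin_continuous_map_preimage)
    moreover have "x \<in> ?T" using x by (simp add: topspace_Proj_lim_top)
    moreover have "?T \<subseteq> ?V"
    proof
      fix y assume y: "y \<in> ?T"
      then obtain b where b: "coherent b" "y = lim_class b"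
        by (auto simp: topspace_Proj_lim_top carr_Proj_lim)
      obtain t where t: "lifts t b" using lifts_exists[OF b(1)] by blast
      have n: "n \<ge> 1" by (simp add: n_def)
      have "b n - a n \<in> J n" using y a(2) b(2) n by (simp add: lim_class_def coset_J_iff)
      then have "trunc n (orbit (b n - a n)) \<in> DI (enat n)" by (simp add: trunc_orbit_in_DI_iff[OF n])
      then have "(trunc n t - trunc n (orbit (b n))) + trunc n (orbit (b n - a n))
          - (trunc n s - trunc n (orbit (a n))) \<in> DI (enat n)"
        using s t n by (intro DI_diff[OF DI_add]) (simp_all add: lifts_def)
      then have "trunc n (t - s) \<in> DI (enat n)" by (simp add: trunc_simps orbit_simps)
      then obtain u where u: "u \<in> DI \<infinity>" "trunc n u = trunc n (t - s)"
        using trunc_surj_DI by blast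
      have "t - u \<in> D \<infinity>" using t u(1) subsetD[OF DI_subset_D] by (intro D_diff) (simp_all add: lifts_def)
      moreover have "(t - u) \<nu> = s \<nu>" if "\<nu> < k" for \<nu>
        using fun_cong[OF u(2), of \<nu>] that by (simp add: trunc_def n_def)
      ultimately have "(t - u) +o DI \<infinity> \<in> U" using k by blast
      moreover have "(t - u) +o DI \<infinity> = t +o DI \<infinity>"
        using add_subgroupD(3)[OF add_subgroup_DI u(1)] by (simp add: coset_DI_iff)
      ultimately have "alpha_hat p \<phi> I y \<in> U" using alpha_hat_lim_class[OF t] b(2) by simp
      then show "y \<in> ?V" using y by (simp add: topspace_Proj_lim_top)
    qed
    ultimately show "\<exists>T. openin (Proj_lim_top p I) T \<and> x \<in> T \<and> T \<subseteq> ?V" by blast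
  qed
qed

text \<open>
  The inverse of \<open>alpha_hat\<close> is induced by a map on sequences each of whose components depends on a
  single component of the argument.
\<close>

lemma continuous_lim_class_unorbit:
  "continuous_map (subtopology (seq_top \<infinity>) (D \<infinity>)) (Proj_lim_top p I) (\<lambda>s. lim_class (unorbit s))"
  unfolding Proj_lim_top_def continuous_map_in_subtopology continuous_map_componentwise
proof (intro conjI ballI)
  have top: "topspace (subtopology (seq_top \<infinity>) (D \<infinity>)) = D \<infinity>"
    using dwork_subset_seqs[of _ \<infinity>] by (auto simp: topspace_seq_top)
  show "(\<lambda>s. lim_class (unorbit s)) \<in> topspace (subtopology (seq_top \<infinity>) (D \<infinity>)) \<rightarrow> carr (Proj_lim p I)"
    using coherent_unorbit by (auto simp: top carr_Proj_lim)
  show "(\<lambda>s. lim_class (unorbit s)) ` topspace (subtopology (seq_top \<infinity>) (D \<infinity>)) \<subseteq> extensional {1..}"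
    by (auto simp: lim_class_def)
  fix n :: nat assume n: "n \<in> {1..}"
  show "continuous_map (subtopology (seq_top \<infinity>) (D \<infinity>)) (discrete_topology (carr (Quot_pow p I n)))
      (\<lambda>s. lim_class (unorbit s) n)"
    unfolding continuous_map_def top
  proof (intro conjI allI impI)
    show "(\<lambda>s. lim_class (unorbit s) n) \<in> D \<infinity> \<rightarrow> topspace (discrete_topology (carr (Quot_pow p I n)))"
      using n by (auto simp: lim_class_def carr_Quot_pow)
    fix U
    show "openin (subtopology (seq_top \<infinity>) (D \<infinity>)) {s \<in> D \<infinity>. lim_class (unorbit s) n \<in> U}"
      unfolding openin_subtopology_seq_top[OF dwork_subset_seqs]
    proof (intro conjI ballI)
      fix s assume s: "s \<in> {s \<in> D \<infinity>. lim_class (unorbit s) n \<in> U}"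
      have "lim_class (unorbit t) n \<in> U" if "\<forall>\<nu><n. t \<nu> = s \<nu>" for t
        using n s that by (simp add: lim_class_def unorbit_def)
      then show "\<exists>k. \<forall>t\<in>D \<infinity>. (\<forall>\<nu><k. t \<nu> = s \<nu>) \<longrightarrow> t \<in> {s \<in> D \<infinity>. lim_class (unorbit s) n \<in> U}"
        by blast
    qed auto
  qed
qed

theorem alpha_hat_homeomorphic: "homeomorphic_map (Proj_lim_top p I) (E_top p \<infinity> I) (alpha_hat p \<phi> I)"
proof (rule bijective_open_imp_homeomorphic_map[OF alpha_hat_continuous])
  have top: "topspace (subtopology (seq_top \<infinity>) (D \<infinity>)) = D \<infinity>"
    using dwork_subset_seqs[of _ \<infinity>] by (auto simp: topspace_seq_top)
  show "alpha_hat p \<phi> I ` topspace (Proj_lim_top p I) = topspace (E_top p \<infinity> I)"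
    and inj: "inj_on (alpha_hat p \<phi> I) (topspace (Proj_lim_top p I))"
    using alpha_hat_bij by (auto simp: bij_betw_def topspace_Proj_lim_top topspace_E_top)
  show "open_map (Proj_lim_top p I) (E_top p \<infinity> I) (alpha_hat p \<phi> I)"
    unfolding open_map_def
  proof (intro allI impI)
    fix W assume W: "openin (Proj_lim_top p I) W"
    have sub: "W \<subseteq> carr (Proj_lim p I)"
      using openin_subset[OF W] by (simp add: topspace_Proj_lim_top)
    have preimage: "s +o DI \<infinity> \<in> alpha_hat p \<phi> I ` W \<longleftrightarrow> lim_class (unorbit s) \<in> W" if s: "s \<in> D \<infinity>" for s
    proof -
      have "lim_class (unorbit s) \<in> carr (Proj_lim p I)"
        using coherent_unorbit[OF s] by (auto simp: carr_Proj_lim)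
      moreover have "alpha_hat p \<phi> I (lim_class (unorbit s)) = s +o DI \<infinity>"
        using lifts_unorbit[OF s] by (rule alpha_hat_lim_class)
      ultimately show ?thesis
        using inj_on_image_mem_iff[OF inj _ , of "lim_class (unorbit s)" W] sub
        by (simp add: topspace_Proj_lim_top)
    qed
    have "{s \<in> D \<infinity>. s +o DI \<infinity> \<in> alpha_hat p \<phi> I ` W} = {s \<in> D \<infinity>. lim_class (unorbit s) \<in> W}"
      using preimage by blast
    moreover have "openin (subtopology (seq_top \<infinity>) (D \<infinity>)) {s \<in> D \<infinity>. lim_class (unorbit s) \<in> W}"
      using openin_continuous_map_preimage[OF continuous_lim_class_unorbit W] by (simp only: top)
    moreover have "alpha_hat p \<phi> I ` W \<subseteq> (\<lambda>s. s +o DI \<infinity>) ` D \<infinity>"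
      using sub alpha_hat_bij unfolding bij_betw_def carr_E by blast
    ultimately show "openin (E_top p \<infinity> I) (alpha_hat p \<phi> I ` W)"
      unfolding E_top_def X_UNIV_eq X_I_eq openin_quotient_top top by simp
  qed
qed

end

section \<open>The comparison theorem\<close>

text \<open>
  The kernel of a presentation of a perfect algebra is stable under \<open>\<phi>\<close> in both directions, because
  \<open>\<pi>(\<phi>(a)) = \<pi>(a)\<^sup>p\<close> and the Frobenius of \<open>R\<close> is injective.
\<close>

lemma frobenius_ideal_ker:
  fixes \<pi> :: "'a::comm_ring \<Rightarrow> 'r::comm_ring"
  assumes p: "prime p" and R: "perfect p TYPE('r)" and \<pi>: "rng_hom \<pi>"
    and A: "torsion_free p TYPE('a)"
    and phi: "rng_hom \<phi>" "lifts_Frobenius p \<phi>" "bij \<phi>"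
  shows "frobenius_ideal p \<phi> (ker \<pi>)"
proof
  have p1: "p \<ge> 1" using prime_gt_0_nat[OF p] by simp
  have Fp: "nsmul p r = 0" for r :: 'r using R by (simp add: perfect_def Fp_algebra_def)
  show "rng_ideal (ker \<pi>)"
    unfolding rng_ideal_def add_subgroup_def
    by (auto simp: ker_def rng_hom_zero[OF \<pi>] rng_hom_diff[OF \<pi>] rng_homD[OF \<pi>])
  show "nsmul p a \<in> ker \<pi>" for a by (simp add: ker_def rng_hom_nsmul[OF \<pi>] Fp)
  show "\<phi> a \<in> ker \<pi> \<longleftrightarrow> a \<in> ker \<pi>" for a
  proof -
    obtain b where "\<phi> a - rpow a p = nsmul p b" using phi(2) by (auto simp: lifts_Frobenius_def)
    then have "\<pi> (\<phi> a - rpow a p) = 0" by (simp add: rng_hom_nsmul[OF \<pi>] Fp)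
    then have "\<pi> (\<phi> a) = rpow (\<pi> a) p"
      by (simp add: rng_hom_diff[OF \<pi>] rng_hom_rpow[OF \<pi> p1])
    moreover have "rpow (\<pi> a) p = rpow 0 p \<longleftrightarrow> \<pi> a = 0"
      using R by (auto simp: perfect_def bij_def dest: injD)
    ultimately show ?thesis by (simp add: ker_def rpow_zero[OF p1])
  qed
qed (fact p A phi)+

theorem theorem6p6:
  fixes p :: nat
    and \<pi> :: "'a::comm_ring \<Rightarrow> 'r::comm_ring"
    and I :: "'a set"
    and \<phi> :: "'a \<Rightarrow> 'a"
  assumes p: "prime p"
    and R: "perfect p TYPE('r)"
    and exact: "rng_hom \<pi>" "surj \<pi>" "I = ker \<pi>"
    and A: "torsion_free p TYPE('a)"
    and phi: "rng_hom \<phi>" "lifts_Frobenius p \<phi>" "bij \<phi>"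
  shows
    "(\<forall>n\<ge>1.
       alpha_n p \<phi> I n \<in> rng_isos (Quot_pow p I n) (E p (enat n) I) \<and>
       (\<forall>C\<in>carr (Quot_pow p I n).
          (phi_quot_inv p \<phi> I n ^^ (n - 1)) (G_ref p I n (alpha_n p \<phi> I n C) (n - 1)) = C) \<and>
       (\<forall>D\<in>carr (E p (enat n) I).
          alpha_n p \<phi> I n ((phi_quot_inv p \<phi> I n ^^ (n - 1)) (G_ref p I n D (n - 1))) = D) \<and>
       (\<forall>C\<in>carr (Quot_pow p I n).
          E_map p n \<pi> \<pi> (\<lambda>r. rpow r p) (alpha_n p \<phi> I n C) =
            alpha_n p \<phi> I n (phi_quot p \<phi> I n C))) \<and>
     alpha_hat p \<phi> I \<in> rng_isos (Proj_lim p I) (E p \<infinity> I) \<and>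
     homeomorphic_map (Proj_lim_top p I) (E_top p \<infinity> I) (alpha_hat p \<phi> I)"
proof -
  interpret frobenius_ideal p \<phi> I
    unfolding exact(3) by (rule frobenius_ideal_ker[OF p R exact(1) A phi])
  show ?thesis
  proof (intro conjI allI impI ballI alpha_hat_iso alpha_hat_homeomorphic)
    fix n :: nat assume n: "n \<ge> 1"
    show "alpha_n p \<phi> I n \<in> rng_isos (Quot_pow p I n) (E p (enat n) I)"
      using n by (rule alpha_n_iso)
    show "(phi_quot_inv p \<phi> I n ^^ (n - 1)) (G_ref p I n (alpha_n p \<phi> I n C) (n - 1)) = C"
      if "C \<in> carr (Quot_pow p I n)" for C
      using that unfolding carr_Quot_pow
      by (elim rangeE) (simp only: alpha_n_coset[OF n] G_ref_inverse[OF n] unorbit_trunc_orbit[OF n])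
    show "alpha_n p \<phi> I n ((phi_quot_inv p \<phi> I n ^^ (n - 1)) (G_ref p I n C (n - 1))) = C"
      if "C \<in> carr (E p (enat n) I)" for C
      using that unfolding carr_E
      by (elim imageE) (simp only: G_ref_inverse[OF n] alpha_n_unorbit[OF n])
    show "E_map p n \<pi> \<pi> (\<lambda>r. rpow r p) (alpha_n p \<phi> I n C) = alpha_n p \<phi> I n (phi_quot p \<phi> I n C)"
      if "C \<in> carr (Quot_pow p I n)" for C
      using that unfolding carr_Quot_pow
      by (elim rangeE) (simp only: E_map_alpha_n[OF exact n])
  qed
qed

end
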